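(* Assume the following. (Dyadic dependence) For any two disjoint index sets $S_1,S_2\subset\{1,\dots,N\}$, the families $\{(\mathbf{x}_n,u_n)\}_{n\in S_1}$ and $\{(\mathbf{x}_m,u_m)\}_{m\in S_2}$ are independent whenever $\psi(n)\cap\psi(m)=\emptyset$ for every $n\in S_1$ and $m\in S_2$. (Bounded support) There are finite constants $C_x,C_u$ with $\|\mathbf{x}_n\|\le C_x$ and $|u_n|\le C_u$ almost surely for all $n$ and $N$. (Identification) $\mathbb{E}[\mathbf{x}_nu_n]=\mathbf{0}$ for all $n$, and there is a constant $c_Q$ with $\lambda_{\min}(Q_N)\ge c_Q>0$ for all $N$. (Variance accumulation) $\Omega_N$ is positive definite and $\delta_N:=N(\mathcal{M}^{H})^{3}/\lambda_{\min}(\Omega_N)^{2}\to0$. (Configuration) $K$ is fixed and $\mathcal{M}^{L}\ge1$ as $G\to\infty$. Write $\rho_g:=4C_x^2M_g/(c_QN)$ and $\rho:=4C_x^2\mathcal{M}^{H}/(c_QN)$. Then: (a) If $\lambda_{\min}(\widehat{Q}_N)\ge c_Q/2$ and $N$ satisfies $\mathcal{M}^{H}/N\le c_Q/(4C_x^2)$, then $\lambda_{\min}(A_{(g)})\ge c_QN/4$ for every $g$, so $\mathcal{E}^{J}_N$ obtains; both conditions hold with probability tending to one, so $\mathbb{P}(\mathcal{E}^{J}_N)\to1$; and (under these two conditions) $\|A_gA_{(g)}^{-1}\|\le\rho_g\le\rho\le1$, with $A_{(g)}^{-1}-A^{-1}=A^{-1}A_gA_{(g)}^{-1}$. (b) On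 $\mathcal{E}^{J}_N$, for every $g$, $\widehat{\boldsymbol{\beta}}_{(g)}-\widehat{\boldsymbol{\beta}}=-A_{(g)}^{-1}T_g$ exactly. (c) On $\mathcal{E}_N$, $\sum_{g=1}^GT_g=\mathbf{0}$. (d) Identically, $\sum_{g=1}^GT_gT_g'=\widehat{\Omega}_N+\sum_dD_dD_d'$, the last sum being over dyads $d$.
   Context: Setting. Units are indexed $g=1,\dots,G$ and all limits are as $G\to\infty$. For each $G$ there are observations $n=1,\dots,N$, $N=N_G$. Each observation carries a nonrandom support (its dyad) $\psi(n)\subset\{1,\dots,G\}$ with $|\psi(n)|=2$; $\psi$ need not be injective. Everything may form a triangular array (the configuration and the joint law of the data may change with $G$). Put $M_g:=\#\{n:g\in\psi(n)\}$, $\mathcal{M}^{H}:=\max_gM_g$, $\mathcal{M}^{L}:=\min_gM_g$, and $\mathbf{1}_{nm}:=\mathbf{1}\{\psi(n)\cap\psi(m)\neq\emptyset\}$. Model: $y_n=\boldsymbol{\beta}'\mathbf{x}_n+u_n$, with $\mathbf{x}_n\in\mathbb{R}^K$ and $u_n\in\mathbb{R}$ random and $\boldsymbol\beta\in\mathbb{R}^K$. Define $S_N:=\sum_n\mathbf{x}_nu_n$, $\Omega_N:=\operatorname{Var}(S_N)$, $Q_N:=N^{-1}\sum_n\mathbb{E}[\mathbf{x}_n\mathbf{x}_n']$, $\widehat{Q}_N:=N^{-1}\sum_n\mathbf{x}_n\mathbf{x}_n'$. Estimators: let $A:=\sum_n\mathbf{x}_n\mathbf{x}_n'$ and let $\mathcal{E}_N$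 be the event that $A$ is invertible. On $\mathcal{E}_N$, $\widehat{\boldsymbol{\beta}}:=A^{-1}\sum_n\mathbf{x}_ny_n$ and $\widehat{u}_n:=y_n-\widehat{\boldsymbol{\beta}}'\mathbf{x}_n$; on the complement, $\widehat{\boldsymbol{\beta}}:=\mathbf{0}$ and $\widehat{u}_n:=y_n$. Put $\widehat{\Omega}_N:=\sum_{n,m}\mathbf{1}_{nm}\widehat{u}_n\widehat{u}_m\mathbf{x}_n\mathbf{x}_m'$. Let $\mathcal{N}_g:=\{n:g\in\psi(n)\}$, $A_g:=\sum_{n\in\mathcal{N}_g}\mathbf{x}_n\mathbf{x}_n'$, $A_{(g)}:=A-A_g$; $\mathcal{E}^{J}_N$ is the event that every $A_{(g)}$, $g=1,\dots,G$, is invertible, and on it $\widehat{\boldsymbol{\beta}}_{(g)}:=A_{(g)}^{-1}\sum_{n\notin\mathcal{N}_g}\mathbf{x}_ny_n$. Further $\mathbf{v}_n:=\mathbf{x}_n\widehat{u}_n$, $T_g:=\sum_{n\in\mathcal{N}_g}\mathbf{v}_n$, and, for a dyad $d$, $D_d:=\sum_{n:\psi(n)=d}\mathbf{v}_n$. Notation: $\lambda_{\min}$ is the smallest eigenvalue; $\|\cdot\|$ is the Euclidean norm for vectors and the spectral norm for matrices. Statements that use the almost sure bounds on $\mathbf{x}_n$ and $u_n$ are understood up to null sets. *)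

theory Defs
  imports "HOL-Probability.Probability"
begin

definition outer :: "real^'k \<Rightarrow> real^'k \<Rightarrow> real^'k^'k" where
  "outer v w = (\<chi> i j. v $ i * w $ j)"

definition eigenvalues :: "real^'k^'k \<Rightarrow> real set" where
  "eigenvalues A = {c. \<exists>v. v \<noteq> 0 \<and> A *v v = c *\<^sub>R v}"

(* Only used for symmetric matrices, whose set of real eigenvalues is nonempty; it is finite
   for every square matrix. *)
definition lambda_min :: "real^'k^'k \<Rightarrow> real" where
  "lambda_min A = Min (eigenvalues A)"

definition pos_definite :: "real^'k^'k \<Rightarrow> bool" where
  "pos_definite A \<longleftrightarrow> transpose A = A \<and> (\<forall>v. v \<noteq> 0 \<longrightarrow> v \<bullet> (A *v v) > 0)"

(* The library norm on matrices is the Frobenius norm; the spectral norm is the operator norm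
   induced by the Euclidean norm. *)
definition spectral_norm :: "real^'k^'k \<Rightarrow> real" where
  "spectral_norm A = onorm (\<lambda>v. A *v v)"

definition cov_matrix :: "'a measure \<Rightarrow> ('a \<Rightarrow> real^'k) \<Rightarrow> real^'k^'k" where
  "cov_matrix M Z =
     (\<integral>\<omega>. outer (Z \<omega> - (\<integral>\<omega>'. Z \<omega>' \<partial>M)) (Z \<omega> - (\<integral>\<omega>'. Z \<omega>' \<partial>M)) \<partial>M)"

(* Units are 1..G, observations 1..N, and psi n is the dyad of observation n. *)

definition dyads :: "nat \<Rightarrow> nat set set" where
  "dyads G = {d. d \<subseteq> {1..G} \<and> card d = 2}"

definition obs_of :: "nat \<Rightarrow> (nat \<Rightarrow> nat set) \<Rightarrow> nat \<Rightarrow> nat set" where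
  "obs_of N psi g = {n \<in> {1..N}. g \<in> psi n}"

definition M_count :: "nat \<Rightarrow> (nat \<Rightarrow> nat set) \<Rightarrow> nat \<Rightarrow> nat" where
  "M_count N psi g = card (obs_of N psi g)"

definition M_high :: "nat \<Rightarrow> nat \<Rightarrow> (nat \<Rightarrow> nat set) \<Rightarrow> nat" where
  "M_high G N psi = Max (M_count N psi ` {1..G})"

definition M_low :: "nat \<Rightarrow> nat \<Rightarrow> (nat \<Rightarrow> nat set) \<Rightarrow> nat" where
  "M_low G N psi = Min (M_count N psi ` {1..G})"

(* Random regressors and errors are functions of the outcome first and the observation second,
   so that x \<omega> is a realised sample. *)

definition score_sum :: "nat \<Rightarrow> ('a \<Rightarrow> nat \<Rightarrow> real^'k) \<Rightarrow> ('a \<Rightarrow> nat \<Rightarrow> real) \<Rightarrow> 'a \<Rightarrow> real^'k" where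
  "score_sum N x u \<omega> = (\<Sum>n\<in>{1..N}. u \<omega> n *\<^sub>R x \<omega> n)"

definition Omega :: "'a measure \<Rightarrow> nat \<Rightarrow> ('a \<Rightarrow> nat \<Rightarrow> real^'k) \<Rightarrow> ('a \<Rightarrow> nat \<Rightarrow> real) \<Rightarrow> real^'k^'k" where
  "Omega M N x u = cov_matrix M (score_sum N x u)"

definition Q_pop :: "'a measure \<Rightarrow> nat \<Rightarrow> ('a \<Rightarrow> nat \<Rightarrow> real^'k) \<Rightarrow> real^'k^'k" where
  "Q_pop M N x = (1 / real N) *\<^sub>R (\<Sum>n\<in>{1..N}. \<integral>\<omega>. outer (x \<omega> n) (x \<omega> n) \<partial>M)"

(* Here x and y are one realised sample. *)

definition A_full :: "nat \<Rightarrow> (nat \<Rightarrow> real^'k) \<Rightarrow> real^'k^'k" where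
  "A_full N x = (\<Sum>n\<in>{1..N}. outer (x n) (x n))"

definition Q_hat :: "nat \<Rightarrow> (nat \<Rightarrow> real^'k) \<Rightarrow> real^'k^'k" where
  "Q_hat N x = (1 / real N) *\<^sub>R (\<Sum>n\<in>{1..N}. outer (x n) (x n))"

definition A_unit :: "nat \<Rightarrow> (nat \<Rightarrow> nat set) \<Rightarrow> (nat \<Rightarrow> real^'k) \<Rightarrow> nat \<Rightarrow> real^'k^'k" where
  "A_unit N psi x g = (\<Sum>n\<in>obs_of N psi g. outer (x n) (x n))"

definition A_del :: "nat \<Rightarrow> (nat \<Rightarrow> nat set) \<Rightarrow> (nat \<Rightarrow> real^'k) \<Rightarrow> nat \<Rightarrow> real^'k^'k" where
  "A_del N psi x g = A_full N x - A_unit N psi x g"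

(* The events E_N and E^J_N, as conditions on the realised sample. *)

definition full_rank :: "nat \<Rightarrow> (nat \<Rightarrow> real^'k) \<Rightarrow> bool" where
  "full_rank N x \<longleftrightarrow> invertible (A_full N x)"

definition jack_full_rank :: "nat \<Rightarrow> nat \<Rightarrow> (nat \<Rightarrow> nat set) \<Rightarrow> (nat \<Rightarrow> real^'k) \<Rightarrow> bool" where
  "jack_full_rank G N psi x \<longleftrightarrow> (\<forall>g\<in>{1..G}. invertible (A_del N psi x g))"

definition beta_hat :: "nat \<Rightarrow> (nat \<Rightarrow> real^'k) \<Rightarrow> (nat \<Rightarrow> real) \<Rightarrow> real^'k" where
  "beta_hat N x y =
     (if full_rank N x then matrix_inv (A_full N x) *v (\<Sum>n\<in>{1..N}. y n *\<^sub>R x n) else 0)"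

(* Off the event full_rank this is y n, since beta_hat is then 0. *)
definition u_hat :: "nat \<Rightarrow> (nat \<Rightarrow> real^'k) \<Rightarrow> (nat \<Rightarrow> real) \<Rightarrow> nat \<Rightarrow> real" where
  "u_hat N x y n = y n - beta_hat N x y \<bullet> x n"

(* Meaningful only under jack_full_rank. *)
definition beta_del :: "nat \<Rightarrow> (nat \<Rightarrow> nat set) \<Rightarrow> (nat \<Rightarrow> real^'k) \<Rightarrow> (nat \<Rightarrow> real) \<Rightarrow> nat \<Rightarrow> real^'k" where
  "beta_del N psi x y g =
     matrix_inv (A_del N psi x g) *v (\<Sum>n\<in>{1..N} - obs_of N psi g. y n *\<^sub>R x n)"

definition v_score :: "nat \<Rightarrow> (nat \<Rightarrow> real^'k) \<Rightarrow> (nat \<Rightarrow> real) \<Rightarrow> nat \<Rightarrow> real^'k" where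
  "v_score N x y n = u_hat N x y n *\<^sub>R x n"

definition T_unit :: "nat \<Rightarrow> (nat \<Rightarrow> nat set) \<Rightarrow> (nat \<Rightarrow> real^'k) \<Rightarrow> (nat \<Rightarrow> real) \<Rightarrow> nat \<Rightarrow> real^'k" where
  "T_unit N psi x y g = (\<Sum>n\<in>obs_of N psi g. v_score N x y n)"

definition D_dyad :: "nat \<Rightarrow> (nat \<Rightarrow> nat set) \<Rightarrow> (nat \<Rightarrow> real^'k) \<Rightarrow> (nat \<Rightarrow> real) \<Rightarrow> nat set \<Rightarrow> real^'k" where
  "D_dyad N psi x y d = (\<Sum>n\<in>{n\<in>{1..N}. psi n = d}. v_score N x y n)"

definition Omega_hat :: "nat \<Rightarrow> (nat \<Rightarrow> nat set) \<Rightarrow> (nat \<Rightarrow> real^'k) \<Rightarrow> (nat \<Rightarrow> real) \<Rightarrow> real^'k^'k" where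
  "Omega_hat N psi x y =
     (\<Sum>n\<in>{1..N}. \<Sum>m\<in>{1..N}.
        (of_bool (psi n \<inter> psi m \<noteq> {}) * u_hat N x y n * u_hat N x y m) *\<^sub>R outer (x n) (x m))"

end

theory Submission
  imports Defs
begin

text \<open>
The variance of a sum of \<open>N\<close> bounded, dyadically dependent variables is of order \<open>N * M_high\<close>, since an
observation shares a unit with at most \<open>2 * M_high\<close> others. Applied to the scores this bounds the
smallest eigenvalue of \<open>Omega\<close> by a multiple of \<open>N * M_high\<close>, so \<open>M_high / N\<close> is at most a constant times
\<open>N * M_high ^ 3 / lambda_min Omega ^ 2\<close> and vanishes. Applied to the products of regressors it
gives, with Chebyshev's inequality, entrywise convergence of \<open>Q_hat - Q_pop\<close> to zero in probability.
Deleting a unit then changes the quadratic form of \<open>A_full\<close> by at most \<open>Cx^2 * M_high\<close>, a negligible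
fraction of its lower bound. The exact identities come from the normal equations and from the fact
that two distinct dyads share at most one unit.
\<close>

subsection \<open>Smallest eigenvalue of a symmetric matrix\<close>

lemma inner_symmetric_matrix:
  fixes A :: "real^'k^'k"
  assumes "transpose A = A"
  shows "v \<bullet> (A *v w) = (A *v v) \<bullet> w"
  by (metis assms dot_lmul_matrix transpose_matrix_vector)

text \<open>First-order condition at a minimiser of the Rayleigh quotient. With the residual
  \<open>w = A *v v - c *\<^sub>R v\<close>, the form of \<open>A - c\<close> at
  \<open>v + t *\<^sub>R w\<close> is \<open>2 * t * a + t\<^sup>2 * b\<close>, where
  \<open>a\<close> is the squared norm of \<open>w\<close>. Nonnegativity for all \<open>t\<close>
  forces \<open>a = 0\<close>.\<close>

lemma eigenvalueI_Rayleigh: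
  fixes A :: "real^'k^'k"
  assumes sym: "transpose A = A"
    and min: "\<And>w. w \<bullet> (A *v w) \<ge> c * (w \<bullet> w)"
    and att: "v \<bullet> (A *v v) = c * (v \<bullet> v)"
  shows "A *v v = c *\<^sub>R v"
proof -
  define w where "w = A *v v - c *\<^sub>R v"
  define a where "a = w \<bullet> w"
  define b where "b = w \<bullet> (A *v w) - c * (w \<bullet> w)"
  have b: "b \<ge> 0" using min[of w] by (simp add: b_def)
  have a: "w \<bullet> (A *v v) - c * (w \<bullet> v) = a"
    by (simp add: a_def w_def inner_diff_left inner_diff_right algebra_simps inner_commute)
  have q: "2 * t * a + t\<^sup>2 * b \<ge> 0" for t
  proof -
    have e: "v \<bullet> (A *v w) = w \<bullet> (A *v v)"
      using inner_symmetric_matrix[OF sym, of v w] by (simp add: inner_commute)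
    have "0 \<le> (v + t *\<^sub>R w) \<bullet> (A *v (v + t *\<^sub>R w)) - c * ((v + t *\<^sub>R w) \<bullet> (v + t *\<^sub>R w))"
      using min[of "v + t *\<^sub>R w"] by simp
    also have "\<dots> = (v \<bullet> (A *v v) - c * (v \<bullet> v)) + 2 * t * (w \<bullet> (A *v v) - c * (w \<bullet> v)) + t\<^sup>2 * b"
      by (simp add: b_def matrix_vector_right_distrib matrix_vector_mult_scaleR inner_add_left
          inner_add_right e algebra_simps power2_eq_square inner_commute[of v w])
    finally show ?thesis using att a by simp
  qed
  \<comment> \<open>The quadratic in \<open>t\<close> is smallest at \<open>- a / b\<close>;
    enlarging the denominator by one covers \<open>b = 0\<close> as well and still gives a negative
    value unless \<open>a = 0\<close>.\<close>
  have "2 * (- a / (b + 1)) * a + (- a / (b + 1))\<^sup>2 * b = - (a\<^sup>2 * (b + 2)) / (b + 1)\<^sup>2"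
    using b by (simp add: divide_simps power2_eq_square) (simp add: algebra_simps)
  with q[of "- a / (b + 1)"] have "a\<^sup>2 * (b + 2) / (b + 1)\<^sup>2 \<le> 0" by simp
  moreover have "(b + 1)\<^sup>2 > 0" using b by (simp add: zero_less_power)
  ultimately have "a\<^sup>2 * (b + 2) \<le> 0" by (simp add: divide_le_0_iff)
  then have "a\<^sup>2 \<le> 0" using b by (simp add: mult_le_0_iff)
  then show ?thesis by (simp add: a_def w_def)
qed

text \<open>Eigenvectors of distinct eigenvalues of a symmetric matrix are orthogonal. Picking one
  per eigenvalue therefore embeds the spectrum injectively into an independent, hence finite, set.
  This makes the \<open>Min\<close> in \<open>lambda_min\<close> a true minimum.\<close>

lemma finite_eigenvalues_symmetric:
  fixes A :: "real^'k^'k"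
  assumes sym: "transpose A = A"
  shows "finite (eigenvalues A)"
proof -
  define f where "f c = (SOME v. v \<noteq> 0 \<and> A *v v = c *\<^sub>R v)" for c
  have f: "f c \<noteq> 0 \<and> A *v f c = c *\<^sub>R f c" if "c \<in> eigenvalues A" for c
    unfolding f_def by (rule someI_ex) (use that in \<open>simp add: eigenvalues_def\<close>)
  have orth: "f c \<bullet> f d = 0" if "c \<in> eigenvalues A" "d \<in> eigenvalues A" "c \<noteq> d" for c d
  proof -
    have "d * (f c \<bullet> f d) = c * (f c \<bullet> f d)"
      using inner_symmetric_matrix[OF sym, of "f c" "f d"] f that by simp
    then show ?thesis using that by simp
  qed
  have inj: "inj_on f (eigenvalues A)"
    by (metis f inj_onI inner_eq_zero_iff orth)
  have "pairwise orthogonal (f ` eigenvalues A)"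
    by (auto simp: pairwise_def orthogonal_def intro!: orth)
  moreover have "0 \<notin> f ` eigenvalues A" using f by force
  ultimately have "independent (f ` eigenvalues A)"
    by (rule pairwise_orthogonal_independent)
  then have "finite (f ` eigenvalues A)" by (rule independent_imp_finite)
  then show ?thesis using inj finite_imageD by blast
qed

text \<open>By compactness the quadratic form attains its minimum over the unit sphere. The
  minimiser is an eigenvector, and every eigenvalue is a value of the form on the sphere, so the
  least eigenvalue is this minimum.\<close>

lemma lambda_min_symmetric:
  fixes A :: "real^'k^'k"
  assumes sym: "transpose A = A"
  obtains v where "norm v = 1" "A *v v = lambda_min A *\<^sub>R v"
    "\<And>w. lambda_min A * (w \<bullet> w) \<le> w \<bullet> (A *v w)"
proof -
  have "continuous_on (sphere 0 1) (\<lambda>v. v \<bullet> (A *v v))"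
    by (intro continuous_intros)
  moreover have "compact (sphere (0::real^'k) 1)" "sphere (0::real^'k) 1 \<noteq> {}"
    by auto
  ultimately obtain v0 where v0: "norm v0 = 1"
    and le: "\<And>w. norm w = 1 \<Longrightarrow> v0 \<bullet> (A *v v0) \<le> w \<bullet> (A *v w)"
    using continuous_attains_inf[of "sphere (0::real^'k) 1" "\<lambda>v. v \<bullet> (A *v v)"] by auto
  define m where "m = v0 \<bullet> (A *v v0)"
  have R: "m * (w \<bullet> w) \<le> w \<bullet> (A *v w)" for w
  proof (cases "w = 0")
    case False
    have "m \<le> (w /\<^sub>R norm w) \<bullet> (A *v (w /\<^sub>R norm w))"
      unfolding m_def by (rule le) (use False in simp)
    also have "\<dots> = (w \<bullet> (A *v w)) / (w \<bullet> w)"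
      by (simp add: matrix_vector_mult_scaleR power2_norm_eq_inner[symmetric] power2_eq_square field_simps)
    finally show ?thesis using False by (simp add: field_simps)
  qed simp
  have v01: "v0 \<bullet> v0 = 1" using v0 by (simp add: power2_norm_eq_inner[symmetric])
  have ev: "A *v v0 = m *\<^sub>R v0"
    by (rule eigenvalueI_Rayleigh[OF sym R]) (simp add: m_def v01)
  then have me: "m \<in> eigenvalues A" unfolding eigenvalues_def mem_Collect_eq using v0 by (intro exI[of _ v0]) auto
  have "m \<le> d" if d: "d \<in> eigenvalues A" for d
  proof -
    obtain v where "v \<noteq> 0" "A *v v = d *\<^sub>R v" using d by (auto simp: eigenvalues_def)
    then show ?thesis using R[of v] by simp
  qed
  then have "lambda_min A = m"
    unfolding lambda_min_def using finite_eigenvalues_symmetric[OF sym] me by (intro Min_eqI) auto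
  then show thesis using that v0 ev R by simp
qed

text \<open>Turns eigenvalue bounds into inequalities between quadratic forms, which can be added,
  scaled and compared pointwise.\<close>

lemma lambda_min_ge_iff:
  fixes A :: "real^'k^'k"
  assumes sym: "transpose A = A"
  shows "c \<le> lambda_min A \<longleftrightarrow> (\<forall>v. c * (v \<bullet> v) \<le> v \<bullet> (A *v v))"
proof
  obtain v where v: "norm v = 1" "A *v v = lambda_min A *\<^sub>R v"
    and R: "\<And>w. lambda_min A * (w \<bullet> w) \<le> w \<bullet> (A *v w)"
    using lambda_min_symmetric[OF sym] by blast
  show "c \<le> lambda_min A" if "\<forall>v. c * (v \<bullet> v) \<le> v \<bullet> (A *v v)"
    using that[rule_format, of v] v by (simp add: power2_norm_eq_inner[symmetric])
  show "\<forall>v. c * (v \<bullet> v) \<le> v \<bullet> (A *v v)" if "c \<le> lambda_min A"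
    using R that by (meson inner_ge_zero mult_right_mono order_trans)
qed

text \<open>Excludes degenerate cases later: without observations, or with the zero bound on the
  regressors, the second moment matrix would be zero, contradicting a positive lower bound on its
  smallest eigenvalue.\<close>

lemma lambda_min_zero: "lambda_min (0 :: real^'k^'k) = 0"
proof -
  have "transpose (0 :: real^'k^'k) = 0" by (simp add: transpose_def vec_eq_iff)
  then obtain v :: "real^'k" where "norm v = 1" "0 *v v = lambda_min (0 :: real^'k^'k) *\<^sub>R v"
    by (rule lambda_min_symmetric)
  then show ?thesis by auto
qed

lemma lambda_min_pos:
  fixes A :: "real^'k^'k"
  assumes "pos_definite A"
  shows "lambda_min A > 0"
proof -
  obtain v where v: "norm v = 1" "A *v v = lambda_min A *\<^sub>R v"
    using assms lambda_min_symmetric[of A] unfolding pos_definite_def by blast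
  then have "v \<noteq> 0" by auto
  with assms have "v \<bullet> (A *v v) > 0" by (simp add: pos_definite_def)
  then show ?thesis using v by (simp add: power2_norm_eq_inner[symmetric])
qed

subsection \<open>Outer products and matrix inverses\<close>

lemma transpose_sum: "transpose (\<Sum>i\<in>S. A i) = (\<Sum>i\<in>S. transpose (A i))"
  by (simp add: transpose_def vec_eq_iff)

lemma transpose_outer: "transpose (outer v w) = outer w v"
  by (simp add: transpose_def outer_def vec_eq_iff mult.commute)

lemma outer_mult_vec: "outer v w *v z = (w \<bullet> z) *\<^sub>R v"
  by (simp add: outer_def vec_eq_iff matrix_vector_mult_def inner_vec_def sum_distrib_left
      sum_distrib_right mult_ac)

lemma sum_matrix_vector_mult:
  fixes A :: "'i \<Rightarrow> real^'k^'m"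
  shows "(\<Sum>i\<in>S. A i) *v z = (\<Sum>i\<in>S. A i *v z)"
  by (induction S rule: infinite_finite_induct) (auto simp: matrix_vector_mult_add_rdistrib)

lemma sum_outer_mult_vec: "(\<Sum>n\<in>S. outer (x n) (x n)) *v z = (\<Sum>n\<in>S. (x n \<bullet> z) *\<^sub>R x n)"
  by (simp add: sum_matrix_vector_mult outer_mult_vec)

lemma inner_sum_outer: "z \<bullet> ((\<Sum>n\<in>S. outer (x n) (x n)) *v z) = (\<Sum>n\<in>S. (x n \<bullet> z)\<^sup>2)"
  by (simp add: sum_outer_mult_vec inner_sum_right power2_eq_square inner_commute)

lemma transpose_sum_outer: "transpose (\<Sum>n\<in>S. outer (x n) (x n)) = (\<Sum>n\<in>S. outer (x n) (x n))"
  by (simp add: transpose_sum transpose_outer)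

lemma outer_sum_scaleR:
  "outer (\<Sum>i\<in>S. a i *\<^sub>R f i) (\<Sum>j\<in>T. b j *\<^sub>R h j)
    = (\<Sum>i\<in>S. \<Sum>j\<in>T. (a i * b j) *\<^sub>R outer (f i) (h j))"
  unfolding outer_def vec_eq_iff sum_component vec_lambda_beta vector_scaleR_component sum_product
  by (intro allI sum.cong refl) simp

lemma invertible_if_inj:
  fixes A :: "real^'k^'k"
  assumes "\<And>v. A *v v = 0 \<Longrightarrow> v = 0"
  shows "invertible A"
  using assms matrix_left_invertible_ker invertible_left_inverse by blast

lemma
  fixes A :: "'a::semiring_1^'n^'m"
  assumes "invertible A"
  shows matrix_inv_right: "A ** matrix_inv A = mat 1"
    and matrix_inv_left: "matrix_inv A ** A = mat 1"
  using someI_ex[OF assms[unfolded invertible_def]] unfolding matrix_inv_def by auto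

lemma matrix_inv_mult_vec:
  fixes A :: "real^'k^'k"
  assumes "invertible A"
  shows "A *v (matrix_inv A *v z) = z" "matrix_inv A *v (A *v z) = z"
  using matrix_inv_right[OF assms] matrix_inv_left[OF assms] by (simp_all add: matrix_vector_mul_assoc)

subsection \<open>Exact identities for unit deletion\<close>

lemma finite_obs_of [simp]: "finite (obs_of N psi g)"
  by (simp add: obs_of_def)

lemma A_del_eq_sum: "A_del N psi x g = (\<Sum>n\<in>{1..N} - obs_of N psi g. outer (x n) (x n))"
proof -
  have "obs_of N psi g \<subseteq> {1..N}" by (auto simp: obs_of_def)
  then show ?thesis by (simp add: A_del_def A_full_def A_unit_def sum_diff)
qed

text \<open>The form of \<open>A_full\<close> is a sum of squares, so a kernel vector is orthogonal
  to every regressor and also lies in the kernel of each \<open>A_del\<close>. Invertibility for one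
  unit suffices, whence \<open>G \<ge> 1\<close>.\<close>

lemma jack_full_rank_imp_full_rank:
  assumes "jack_full_rank G N psi x" "G \<ge> 1"
  shows "full_rank N x"
  unfolding full_rank_def
proof (rule invertible_if_inj)
  fix v assume v: "A_full N x *v v = 0"
  have inv: "invertible (A_del N psi x 1)" using assms by (auto simp: jack_full_rank_def)
  have "(\<Sum>n\<in>{1..N}. (x n \<bullet> v)\<^sup>2) = 0"
    using v by (simp add: inner_sum_outer[symmetric] A_full_def)
  then have "x n \<bullet> v = 0" if "n \<in> {1..N}" for n
    using that by (simp add: sum_nonneg_eq_0_iff)
  then have "A_del N psi x 1 *v v = 0"
    by (simp add: A_del_eq_sum sum_outer_mult_vec)
  then show "v = 0" using matrix_inv_mult_vec(2)[OF inv, of v] by simp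
qed

text \<open>Residuals are orthogonal to the regressors; this is the property of
  \<open>beta_hat\<close> behind both the deletion formula and the zero sum of the
  \<open>T_unit\<close>.\<close>

lemma normal_equations:
  assumes "full_rank N x"
  shows "(\<Sum>n\<in>{1..N}. v_score N x y n) = 0"
proof -
  have "A_full N x *v beta_hat N x y = (\<Sum>n\<in>{1..N}. y n *\<^sub>R x n)"
    using assms by (simp add: beta_hat_def matrix_inv_mult_vec full_rank_def)
  then show ?thesis
    by (simp add: v_score_def u_hat_def A_full_def sum_outer_mult_vec scaleR_left_diff_distrib
        sum_subtractf inner_commute)
qed

text \<open>The scores of the retained observations are summed in two ways: the normal equations
  give minus \<open>T_unit\<close>, while expanding \<open>u_hat\<close> gives the retained cross
  product minus \<open>A_del\<close> applied to \<open>beta_hat\<close>. Inverting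
  \<open>A_del\<close> yields the formula.\<close>

lemma beta_del_minus_beta_hat:
  assumes J: "jack_full_rank G N psi x" and g: "g \<in> {1..G}"
  shows "beta_del N psi x y g - beta_hat N x y
    = - (matrix_inv (A_del N psi x g) *v T_unit N psi x y g)"
proof -
  have inv: "invertible (A_del N psi x g)" using J g by (auto simp: jack_full_rank_def)
  have full: "full_rank N x" using jack_full_rank_imp_full_rank[OF J] g by simp
  let ?S = "{1..N} - obs_of N psi g"
  have sub: "obs_of N psi g \<subseteq> {1..N}" by (auto simp: obs_of_def)
  have "(\<Sum>n\<in>?S. v_score N x y n) = - T_unit N psi x y g"
    using normal_equations[OF full, of y] sub by (simp add: T_unit_def sum_diff)
  moreover have "(\<Sum>n\<in>?S. v_score N x y n)
      = (\<Sum>n\<in>?S. y n *\<^sub>R x n) - A_del N psi x g *v beta_hat N x y"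
    by (simp add: v_score_def u_hat_def A_del_eq_sum sum_outer_mult_vec scaleR_left_diff_distrib
        sum_subtractf inner_commute)
  ultimately have "(\<Sum>n\<in>?S. y n *\<^sub>R x n)
      = A_del N psi x g *v beta_hat N x y - T_unit N psi x y g"
    by (simp add: algebra_simps)
  then show ?thesis
    by (simp add: beta_del_def matrix_vector_mult_diff_distrib matrix_inv_mult_vec[OF inv])
qed

text \<open>Double counting: an observation occurs once for each unit in its support, that is twice
  for a dyad.\<close>

lemma sum_over_units:
  fixes f :: "nat \<Rightarrow> 'b::real_vector"
  assumes "\<And>n. n \<in> {1..N} \<Longrightarrow> psi n \<subseteq> {1..G}"
  shows "(\<Sum>g\<in>{1..G}. \<Sum>n\<in>obs_of N psi g. f n) = (\<Sum>n\<in>{1..N}. real (card (psi n)) *\<^sub>R f n)"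
proof -
  have "(\<Sum>g\<in>{1..G}. \<Sum>n\<in>obs_of N psi g. f n) = (\<Sum>n\<in>{1..N}. \<Sum>g | g \<in> {1..G} \<and> g \<in> psi n. f n)"
    unfolding obs_of_def by (rule sum.swap_restrict) auto
  also have "\<dots> = (\<Sum>n\<in>{1..N}. real (card (psi n)) *\<^sub>R f n)"
  proof (rule sum.cong)
    fix n assume "n \<in> {1..N}"
    then have "{g. g \<in> {1..G} \<and> g \<in> psi n} = psi n" using assms by blast
    then show "(\<Sum>g | g \<in> {1..G} \<and> g \<in> psi n. f n) = real (card (psi n)) *\<^sub>R f n"
      by (simp add: sum_constant_scaleR)
  qed simp
  finally show ?thesis .
qed

lemma sum_T_unit:
  assumes "\<forall>n\<in>{1..N}. psi n \<in> dyads G" "full_rank N x"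
  shows "(\<Sum>g\<in>{1..G}. T_unit N psi x y g) = 0"
proof -
  have "(\<Sum>g\<in>{1..G}. T_unit N psi x y g) = (\<Sum>n\<in>{1..N}. real (card (psi n)) *\<^sub>R v_score N x y n)"
    unfolding T_unit_def by (rule sum_over_units) (use assms in \<open>auto simp: dyads_def\<close>)
  also have "\<dots> = 2 *\<^sub>R (\<Sum>n\<in>{1..N}. v_score N x y n)"
    unfolding scaleR_sum_right using assms by (intro sum.cong) (auto simp: dyads_def)
  finally show ?thesis using normal_equations[OF assms(2)] by simp
qed

lemma finite_dyads: "finite (dyads G)"
  by (rule finite_subset[of _ "Pow {1..G}"]) (auto simp: dyads_def)

text \<open>Two dyads share no unit, one unit, or both and are then equal. The indicator of equality
  is the source of the dyad correction \<open>D_dyad\<close>.\<close>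

lemma card_dyads_Int:
  assumes "d \<in> dyads G" "e \<in> dyads G"
  shows "card (d \<inter> e) = of_bool (d \<inter> e \<noteq> {}) + of_bool (d = e)"
proof -
  have f: "finite d" "finite e" and c: "card d = 2" "card e = 2"
    using assms by (auto simp: dyads_def intro: card_ge_0_finite)
  have "card (d \<inter> e) \<le> 2" using card_mono[OF f(1), of "d \<inter> e"] c by simp
  moreover have "card (d \<inter> e) = 0 \<longleftrightarrow> d \<inter> e = {}" using f by simp
  moreover have "card (d \<inter> e) = 2 \<longleftrightarrow> d = e"
  proof
    assume "card (d \<inter> e) = 2"
    then have "d \<inter> e = d" "d \<inter> e = e"
      using f c card_subset_eq[of d "d \<inter> e"] card_subset_eq[of e "d \<inter> e"] by auto
    then show "d = e" by simp
  qed (use c in simp)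
  ultimately show ?thesis using c by (cases "card (d \<inter> e)"; cases "card (d \<inter> e) - 1") auto
qed

text \<open>All three terms are double sums of
  \<open>outer (v_score N x y n) (v_score N x y m)\<close> and differ only in their weights: the
  number of shared units on the left, the indicators of meeting and of equal dyads on the right. The
  weights agree by \<open>card_dyads_Int\<close>.\<close>

lemma sum_outer_T_unit:
  assumes psi: "\<forall>n\<in>{1..N}. psi n \<in> dyads G"
  shows "(\<Sum>g\<in>{1..G}. outer (T_unit N psi x y g) (T_unit N psi x y g))
    = Omega_hat N psi x y + (\<Sum>d\<in>dyads G. outer (D_dyad N psi x y d) (D_dyad N psi x y d))"
proof -
  let ?I = "{1..N}"
  let ?v = "v_score N x y"
  let ?o = "\<lambda>n m. outer (?v n) (?v m)"
  have T: "outer (T_unit N psi x y g) (T_unit N psi x y g)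
      = (\<Sum>n\<in>?I. \<Sum>m\<in>?I. of_bool (g \<in> psi n \<inter> psi m) *\<^sub>R ?o n m)" for g
  proof -
    have "T_unit N psi x y g = (\<Sum>n\<in>?I. of_bool (g \<in> psi n) *\<^sub>R ?v n)"
      unfolding T_unit_def obs_of_def by (simp only: sum.inter_filter[OF finite_atLeastAtMost], intro sum.cong) auto
    then show ?thesis
      by (simp only: outer_sum_scaleR of_bool_conj Int_iff)
  qed
  have D: "outer (D_dyad N psi x y d) (D_dyad N psi x y d)
      = (\<Sum>n\<in>?I. \<Sum>m\<in>?I. of_bool (psi n = d \<and> psi m = d) *\<^sub>R ?o n m)" for d
  proof -
    have "D_dyad N psi x y d = (\<Sum>n\<in>?I. of_bool (psi n = d) *\<^sub>R ?v n)"
      unfolding D_dyad_def by (simp only: sum.inter_filter[OF finite_atLeastAtMost], intro sum.cong) auto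
    then show ?thesis
      by (simp only: outer_sum_scaleR of_bool_conj Int_iff)
  qed
  \<comment> \<open>The index type is left arbitrary because the exchange serves sums over units and
    sums over dyads.\<close>
  have swap: "(\<Sum>g\<in>S. \<Sum>n\<in>?I. \<Sum>m\<in>?I. F g n m *\<^sub>R ?o n m)
      = (\<Sum>n\<in>?I. \<Sum>m\<in>?I. (\<Sum>g\<in>S. F g n m) *\<^sub>R ?o n m)"
    for S :: "'z set" and F :: "'z \<Rightarrow> nat \<Rightarrow> nat \<Rightarrow> real"
    by (subst sum.swap, rule sum.cong, simp, subst sum.swap) (simp add: scaleR_sum_left)
  have "(\<Sum>g\<in>{1..G}. outer (T_unit N psi x y g) (T_unit N psi x y g))
      = (\<Sum>n\<in>?I. \<Sum>m\<in>?I. real (card (psi n \<inter> psi m)) *\<^sub>R ?o n m)"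
  proof -
    have "(\<Sum>g\<in>{1..G}. of_bool (g \<in> psi n \<inter> psi m)) = real (card (psi n \<inter> psi m))"
      if "n \<in> ?I" "m \<in> ?I" for n m
    proof -
      have "{1..G} \<inter> {g. g \<in> psi n \<inter> psi m} = psi n \<inter> psi m"
        using psi that by (fastforce simp: dyads_def)
      then show ?thesis by (subst sum_of_bool_eq) simp_all
    qed
    then show ?thesis unfolding T swap by simp
  qed
  also have "\<dots> = (\<Sum>n\<in>?I. \<Sum>m\<in>?I. of_bool (psi n \<inter> psi m \<noteq> {}) *\<^sub>R ?o n m)
      + (\<Sum>n\<in>?I. \<Sum>m\<in>?I. of_bool (psi n = psi m) *\<^sub>R ?o n m)"
    unfolding sum.distrib[symmetric] using psi
    by (intro sum.cong refl) (simp add: card_dyads_Int[of _ G] scaleR_left_distrib)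
  also have "(\<Sum>n\<in>?I. \<Sum>m\<in>?I. of_bool (psi n \<inter> psi m \<noteq> {}) *\<^sub>R ?o n m) = Omega_hat N psi x y"
    unfolding Omega_hat_def v_score_def
    by (intro sum.cong refl) (simp add: outer_def vec_eq_iff mult_ac)
  also have "(\<Sum>n\<in>?I. \<Sum>m\<in>?I. of_bool (psi n = psi m) *\<^sub>R ?o n m)
      = (\<Sum>d\<in>dyads G. outer (D_dyad N psi x y d) (D_dyad N psi x y d))"
  proof -
    have "(\<Sum>d\<in>dyads G. of_bool (psi n = d \<and> psi m = d)) = (of_bool (psi n = psi m) :: real)"
      if "n \<in> ?I" "m \<in> ?I" for n m
    proof -
      have "(\<Sum>d\<in>dyads G. of_bool (psi n = d \<and> psi m = d) :: real)
          = (\<Sum>d\<in>dyads G. if d = psi n then of_bool (psi n = psi m) else 0)"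
        by (intro sum.cong) auto
      then show ?thesis using psi that finite_dyads by (simp add: sum.delta)
    qed
    then show ?thesis unfolding D swap by simp
  qed
  finally show ?thesis .
qed

subsection \<open>Variance of dyadically dependent sums\<close>

lemma M_count_le_M_high: "g \<in> {1..G} \<Longrightarrow> M_count N psi g \<le> M_high G N psi"
  unfolding M_high_def by (intro Max_ge) auto

text \<open>An observation meeting \<open>psi n\<close> contains one of its two units; the count
  includes \<open>n\<close> itself.\<close>

lemma card_meeting_le:
  assumes "psi n \<in> dyads G"
  shows "card {m \<in> {1..N}. psi n \<inter> psi m \<noteq> {}} \<le> 2 * M_high G N psi"
proof -
  have d: "psi n \<subseteq> {1..G}" "card (psi n) = 2" using assms by (auto simp: dyads_def)
  have "{m \<in> {1..N}. psi n \<inter> psi m \<noteq> {}} = (\<Union>g\<in>psi n. obs_of N psi g)"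
    by (auto simp: obs_of_def)
  also have "card \<dots> \<le> (\<Sum>g\<in>psi n. M_count N psi g)"
    unfolding M_count_def using d by (intro card_UN_le) (auto intro: card_ge_0_finite)
  also have "\<dots> \<le> (\<Sum>g\<in>psi n. M_high G N psi)"
    using d by (intro sum_mono M_count_le_M_high) auto
  finally show ?thesis using d by simp
qed

text \<open>The variance is the sum of all covariances. Those of disjoint dyads vanish by
  independence, the others are at most \<open>4 * B\<^sup>2\<close>, and each \<open>n\<close> has
  at most \<open>2 * M_high G N psi\<close> partners; hence the factor 8.\<close>

lemma (in prob_space) variance_dyadic_sum_le:
  fixes X :: "nat \<Rightarrow> 'a \<Rightarrow> real"
  assumes psi: "\<And>n. n \<in> {1..N} \<Longrightarrow> psi n \<in> dyads G"
    and meas: "\<And>n. n \<in> {1..N} \<Longrightarrow> X n \<in> borel_measurable M"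
    and bd: "\<And>n. n \<in> {1..N} \<Longrightarrow> AE \<omega> in M. \<bar>X n \<omega>\<bar> \<le> B"
    and ind: "\<And>n m. n \<in> {1..N} \<Longrightarrow> m \<in> {1..N} \<Longrightarrow> psi n \<inter> psi m = {} \<Longrightarrow>
                indep_var borel (X n) borel (X m)"
  shows "variance (\<lambda>\<omega>. \<Sum>n\<in>{1..N}. X n \<omega>) \<le> 8 * real N * real (M_high G N psi) * B\<^sup>2"
proof -
  let ?I = "{1..N}"
  define Y where "Y n \<omega> = X n \<omega> - expectation (X n)" for n \<omega>
  have iX: "integrable M (X n)" if "n \<in> ?I" for n
    using meas[OF that] bd[OF that] by (intro integrable_const_bound[of _ B]) auto
  have mY: "Y n \<in> borel_measurable M" if "n \<in> ?I" for n
    using meas[OF that] unfolding Y_def by measurable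
  \<comment> \<open>The mean lies between \<open>- B\<close> and \<open>B\<close> too, so centring
    at most doubles the bound.\<close>
  have bY: "AE \<omega> in M. \<bar>Y n \<omega>\<bar> \<le> 2 * B" if n: "n \<in> ?I" for n
  proof -
    have "AE \<omega> in M. - B \<le> X n \<omega>" "AE \<omega> in M. X n \<omega> \<le> B"
      using bd[OF n] by (auto elim!: eventually_mono)
    then have "- B \<le> expectation (X n)" "expectation (X n) \<le> B"
      using integral_ge_const[OF iX[OF n]] integral_le_const[OF iX[OF n]] by auto
    then show ?thesis using bd[OF n] by (auto simp: Y_def elim!: eventually_mono)
  qed
  have bYY: "AE \<omega> in M. \<bar>Y n \<omega> * Y m \<omega>\<bar> \<le> 4 * B\<^sup>2" if "n \<in> ?I" "m \<in> ?I" for n m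
    using bY[OF that(1)] bY[OF that(2)]
  proof eventually_elim
    case (elim \<omega>)
    then have "\<bar>Y n \<omega>\<bar> * \<bar>Y m \<omega>\<bar> \<le> (2 * B) * (2 * B)" by (intro mult_mono) auto
    then show ?case by (simp add: abs_mult power2_eq_square)
  qed
  have iYY: "integrable M (\<lambda>\<omega>. Y n \<omega> * Y m \<omega>)" if "n \<in> ?I" "m \<in> ?I" for n m
    using mY[OF that(1)] mY[OF that(2)] bYY[OF that] by (intro integrable_const_bound[of _ "4 * B\<^sup>2"]) auto
  have EYY: "expectation (\<lambda>\<omega>. Y n \<omega> * Y m \<omega>) \<le> 4 * B\<^sup>2 * of_bool (psi n \<inter> psi m \<noteq> {})"
    if n: "n \<in> ?I" and m: "m \<in> ?I" for n m
  proof (cases "psi n \<inter> psi m = {}")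
    case True
    have "indep_var borel ((\<lambda>a. a - expectation (X n)) \<circ> X n) borel ((\<lambda>a. a - expectation (X m)) \<circ> X m)"
      by (rule indep_var_compose[OF ind[OF n m True]]) auto
    then have i: "indep_var borel (Y n) borel (Y m)" by (simp add: comp_def Y_def[abs_def])
    have iY: "integrable M (Y n)" if "n \<in> ?I" for n
      using iX[OF that] unfolding Y_def by auto
    have "expectation (Y n) = 0" using iX[OF n] unfolding Y_def by (simp add: prob_space)
    then show ?thesis
      using indep_var_lebesgue_integral[OF i iY[OF n] iY[OF m]] True by simp
  next
    case False
    have "AE \<omega> in M. Y n \<omega> * Y m \<omega> \<le> 4 * B\<^sup>2" using bYY[OF n m] by eventually_elim linarith
    then show ?thesis using integral_le_const[OF iYY[OF n m]] False by simp
  qed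
  have "variance (\<lambda>\<omega>. \<Sum>n\<in>?I. X n \<omega>) = expectation (\<lambda>\<omega>. (\<Sum>n\<in>?I. Y n \<omega>)\<^sup>2)"
    unfolding Y_def using iX by (simp add: sum_subtractf Bochner_Integration.integral_sum)
  also have "\<dots> = expectation (\<lambda>\<omega>. \<Sum>n\<in>?I. \<Sum>m\<in>?I. Y n \<omega> * Y m \<omega>)"
    by (simp add: power2_eq_square sum_product)
  also have "\<dots> = (\<Sum>n\<in>?I. \<Sum>m\<in>?I. expectation (\<lambda>\<omega>. Y n \<omega> * Y m \<omega>))"
    by (subst Bochner_Integration.integral_sum)
       (auto intro!: sum.cong Bochner_Integration.integral_sum Bochner_Integration.integrable_sum iYY)
  also have "\<dots> \<le> (\<Sum>n\<in>?I. \<Sum>m\<in>?I. 4 * B\<^sup>2 * of_bool (psi n \<inter> psi m \<noteq> {}))"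
    by (intro sum_mono EYY)
  also have "\<dots> = (\<Sum>n\<in>?I. 4 * B\<^sup>2 * real (card {m \<in> ?I. psi n \<inter> psi m \<noteq> {}}))"
    by (simp add: sum_distrib_left[symmetric] Int_def)
  also have "\<dots> \<le> (\<Sum>n\<in>?I. 4 * B\<^sup>2 * real (2 * M_high G N psi))"
    by (intro sum_mono mult_left_mono of_nat_mono card_meeting_le psi) auto
  also have "\<dots> = 8 * real N * real (M_high G N psi) * B\<^sup>2" by simp
  finally show ?thesis .
qed

section \<open>Outer products of random vectors and the quadratic form of a covariance
  matrix\<close>

lemma norm_outer: "norm (outer v w) = norm v * norm w"
proof -
  have "norm (outer v w) = L2_set (\<lambda>i. norm (v $ i *\<^sub>R w)) UNIV"
    by (simp add: norm_vec_def outer_def scaleR_vec_def)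
  also have "\<dots> = norm v * norm w"
    by (simp add: norm_vec_def[of v] L2_set_left_distrib)
  finally show ?thesis .
qed

lemma borel_measurable_vec_lambda:
  fixes f :: "'k::finite \<Rightarrow> 'a \<Rightarrow> 'b::euclidean_space"
  assumes "\<And>i. f i \<in> borel_measurable M"
  shows "(\<lambda>\<omega>. \<chi> i. f i \<omega>) \<in> borel_measurable M"
proof (rule borel_measurable_euclidean_space[THEN iffD2], rule ballI)
  fix b :: "'b^'k"
  show "(\<lambda>\<omega>. (\<chi> i. f i \<omega>) \<bullet> b) \<in> borel_measurable M"
    using assms by (simp add: inner_vec_def)
qed

lemma borel_measurable_vec_nth:
  fixes f :: "'a \<Rightarrow> ('b::euclidean_space)^'k"
  assumes "f \<in> borel_measurable M"
  shows "(\<lambda>\<omega>. f \<omega> $ i) \<in> borel_measurable M"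
  by (rule borel_measurable_continuous_on[OF _ assms]) (intro continuous_intros)

lemma borel_measurable_outer:
  assumes "f \<in> borel_measurable M" "g \<in> borel_measurable M"
  shows "(\<lambda>\<omega>. outer (f \<omega>) (g \<omega>)) \<in> borel_measurable M"
  unfolding outer_def
  by (intro borel_measurable_vec_lambda borel_measurable_times borel_measurable_vec_nth assms)

lemma borel_measurable_sum_outer:
  assumes "\<And>n. n \<in> S \<Longrightarrow> (\<lambda>\<omega>. x \<omega> n) \<in> borel_measurable M"
  shows "(\<lambda>\<omega>. \<Sum>n\<in>S. outer (x \<omega> n) (x \<omega> n)) \<in> borel_measurable M"
  by (intro borel_measurable_sum borel_measurable_outer assms)

lemma bounded_linear_vec_nth2: "bounded_linear (\<lambda>A::real^'k^'m. A $ i $ j)"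
  using bounded_linear_compose[OF bounded_linear_vec_nth bounded_linear_vec_nth] .

text \<open>Linearity in the matrix lets the form pass through matrix-valued integrals; continuity
  makes lower bounds on the form closed conditions.\<close>

lemma bounded_linear_quadratic_form: "bounded_linear (\<lambda>A::real^'k^'k. v \<bullet> (A *v v))"
  unfolding linear_conv_bounded_linear[symmetric]
  by (rule linearI) (simp_all add: matrix_vector_mult_add_rdistrib inner_add_right
      scaleR_matrix_vector_assoc[symmetric])

lemma (in prob_space) integrable_outer:
  fixes f :: "'a \<Rightarrow> real^'k"
  assumes m: "f \<in> borel_measurable M" and bd: "AE \<omega> in M. norm (f \<omega>) \<le> B"
  shows "integrable M (\<lambda>\<omega>. outer (f \<omega>) (f \<omega>))"
proof (rule integrable_const_bound)
  show "AE \<omega> in M. norm (outer (f \<omega>) (f \<omega>)) \<le> B * B"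
    using bd by eventually_elim (auto simp: norm_outer intro!: mult_mono intro: order_trans[OF norm_ge_zero])
qed (intro borel_measurable_outer m)

text \<open>Inside the integral the form of an outer product is the square of a centred projection,
  so matrix statements reduce to variances of scalars.\<close>

lemma (in prob_space) quadratic_form_cov_matrix:
  fixes Z :: "'a \<Rightarrow> real^'k"
  assumes m: "Z \<in> borel_measurable M" and bd: "AE \<omega> in M. norm (Z \<omega>) \<le> B"
  shows "v \<bullet> (cov_matrix M Z *v v) = variance (\<lambda>\<omega>. v \<bullet> Z \<omega>)"
proof -
  let ?\<mu> = "\<integral>\<omega>. Z \<omega> \<partial>M"
  have iZ: "integrable M Z" using bd m by (rule integrable_const_bound)
  have "AE \<omega> in M. norm (Z \<omega> - ?\<mu>) \<le> B + norm ?\<mu>"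
    using bd by eventually_elim (metis add_mono_thms_linordered_semiring(3) norm_triangle_ineq4 order_trans)
  then have int: "integrable M (\<lambda>\<omega>. outer (Z \<omega> - ?\<mu>) (Z \<omega> - ?\<mu>))"
    using m by (intro integrable_outer) auto
  have "v \<bullet> (cov_matrix M Z *v v) = (\<integral>\<omega>. v \<bullet> (outer (Z \<omega> - ?\<mu>) (Z \<omega> - ?\<mu>) *v v) \<partial>M)"
    unfolding cov_matrix_def by (rule integral_bounded_linear[OF bounded_linear_quadratic_form int, symmetric])
  also have "\<dots> = (\<integral>\<omega>. (v \<bullet> Z \<omega> - v \<bullet> ?\<mu>)\<^sup>2 \<partial>M)"
    by (simp add: outer_mult_vec power2_eq_square inner_diff_right inner_commute inner_diff_left)
  also have "v \<bullet> ?\<mu> = expectation (\<lambda>\<omega>. v \<bullet> Z \<omega>)"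
    by (rule integral_inner_right[symmetric]) (use iZ in auto)
  finally show ?thesis .
qed

text \<open>One row of the triangular array. The bounds proved here hold for each fixed
  \<open>G\<close>, with constants that do not vary with \<open>G\<close>.\<close>

locale dyadic_sample = prob_space M for M :: "'a measure" +
  fixes G N :: nat and psi :: "nat \<Rightarrow> nat set"
    and x :: "'a \<Rightarrow> nat \<Rightarrow> real^'k" and u :: "'a \<Rightarrow> nat \<Rightarrow> real" and Cx Cu :: real
  assumes support: "n \<in> {1..N} \<Longrightarrow> psi n \<in> dyads G"
    and measurable_x: "n \<in> {1..N} \<Longrightarrow> (\<lambda>\<omega>. x \<omega> n) \<in> borel_measurable M"
    and measurable_u: "n \<in> {1..N} \<Longrightarrow> (\<lambda>\<omega>. u \<omega> n) \<in> borel_measurable M"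
    and bounded: "n \<in> {1..N} \<Longrightarrow> AE \<omega> in M. norm (x \<omega> n) \<le> Cx \<and> \<bar>u \<omega> n\<bar> \<le> Cu"
    and dyadic_dependence: "S1 \<subseteq> {1..N} \<Longrightarrow> S2 \<subseteq> {1..N} \<Longrightarrow> S1 \<inter> S2 = {} \<Longrightarrow>
          (\<And>n m. n \<in> S1 \<Longrightarrow> m \<in> S2 \<Longrightarrow> psi n \<inter> psi m = {}) \<Longrightarrow>
          indep_var
            (Pi\<^sub>M S1 (\<lambda>_. borel :: ((real^'k) \<times> real) measure)) (\<lambda>\<omega>. \<lambda>n\<in>S1. (x \<omega> n, u \<omega> n))
            (Pi\<^sub>M S2 (\<lambda>_. borel :: ((real^'k) \<times> real) measure)) (\<lambda>\<omega>. \<lambda>m\<in>S2. (x \<omega> m, u \<omega> m))"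
begin

lemma indep_var_disjoint_dyads:
  assumes n: "n \<in> {1..N}" and m: "m \<in> {1..N}" and disj: "psi n \<inter> psi m = {}"
    and h: "h \<in> borel_measurable borel"
  shows "indep_var borel (\<lambda>\<omega>. h (x \<omega> n, u \<omega> n) :: real) borel (\<lambda>\<omega>. h (x \<omega> m, u \<omega> m))"
proof -
  \<comment> \<open>Nonempty disjoint supports force \<open>n \<noteq> m\<close>, so the two
    singletons are disjoint index sets as \<open>dyadic_dependence\<close> requires.\<close>
  have "psi n \<noteq> {}" using support[OF n] by (auto simp: dyads_def)
  then have "n \<noteq> m" using disj by auto
  then have ind: "indep_var
      (Pi\<^sub>M {n} (\<lambda>_. borel :: ((real^'k) \<times> real) measure)) (\<lambda>\<omega>. \<lambda>n\<in>{n}. (x \<omega> n, u \<omega> n))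
      (Pi\<^sub>M {m} (\<lambda>_. borel :: ((real^'k) \<times> real) measure)) (\<lambda>\<omega>. \<lambda>m\<in>{m}. (x \<omega> m, u \<omega> m))"
    using n m disj by (intro dyadic_dependence) auto
  have "(\<lambda>f. h (f i)) \<in> borel_measurable (Pi\<^sub>M {i} (\<lambda>_. borel :: ((real^'k) \<times> real) measure))" for i
    by (rule measurable_compose[OF _ h]) (rule measurable_component_singleton, simp)
  then have "indep_var borel ((\<lambda>f. h (f n)) \<circ> (\<lambda>\<omega>. \<lambda>n\<in>{n}. (x \<omega> n, u \<omega> n)))
      borel ((\<lambda>f. h (f m)) \<circ> (\<lambda>\<omega>. \<lambda>m\<in>{m}. (x \<omega> m, u \<omega> m)))"
    by (intro indep_var_compose[OF ind])
  then show ?thesis by (simp add: comp_def)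
qed

text \<open>The smallest eigenvalue lies below the form at any unit vector \<open>v\<close>, and
  there the form is the variance of a sum of scalar scores bounded by
  \<open>Cu * Cx\<close>.\<close>

lemma lambda_min_Omega_le:
  assumes sym: "transpose (Omega M N x u) = Omega M N x u"
  shows "lambda_min (Omega M N x u) \<le> 8 * real N * real (M_high G N psi) * (Cu * Cx)\<^sup>2"
proof -
  obtain v :: "real^'k" where v: "norm v = 1" using vector_choose_size[of 1] by auto
  have ae: "AE \<omega> in M. norm (u \<omega> n *\<^sub>R x \<omega> n) \<le> Cu * Cx" if "n \<in> {1..N}" for n
    using bounded[OF that] by eventually_elim (auto intro!: mult_mono)
  have m: "score_sum N x u \<in> borel_measurable M"
    unfolding score_sum_def by (intro borel_measurable_sum borel_measurable_scaleR measurable_x measurable_u)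
  have "AE \<omega> in M. \<forall>n\<in>{1..N}. norm (u \<omega> n *\<^sub>R x \<omega> n) \<le> Cu * Cx"
    using ae by (intro AE_finite_allI) auto
  then have "AE \<omega> in M. norm (score_sum N x u \<omega>) \<le> (\<Sum>n\<in>{1..N}. Cu * Cx)"
    unfolding score_sum_def by eventually_elim (intro sum_norm_le, blast)
  then have "v \<bullet> (Omega M N x u *v v) = variance (\<lambda>\<omega>. v \<bullet> score_sum N x u \<omega>)"
    unfolding Omega_def by (rule quadratic_form_cov_matrix[OF m])
  also have "\<dots> = variance (\<lambda>\<omega>. \<Sum>n\<in>{1..N}. v \<bullet> (u \<omega> n *\<^sub>R x \<omega> n))"
    by (simp add: score_sum_def inner_sum_right)
  also have "\<dots> \<le> 8 * real N * real (M_high G N psi) * (Cu * Cx)\<^sup>2"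
  proof (rule variance_dyadic_sum_le[OF support])
    fix n assume n: "n \<in> {1..N}"
    show "(\<lambda>\<omega>. v \<bullet> (u \<omega> n *\<^sub>R x \<omega> n)) \<in> borel_measurable M"
      using measurable_x[OF n] measurable_u[OF n] by measurable
    show "AE \<omega> in M. \<bar>v \<bullet> (u \<omega> n *\<^sub>R x \<omega> n)\<bar> \<le> Cu * Cx"
      using ae[OF n]
    proof eventually_elim
      case (elim \<omega>)
      then show ?case using Cauchy_Schwarz_ineq2[of v "u \<omega> n *\<^sub>R x \<omega> n"] v by simp
    qed
  next
    fix n k assume nk: "n \<in> {1..N}" "k \<in> {1..N}" "psi n \<inter> psi k = {}"
    have "(\<lambda>p. v \<bullet> (snd p *\<^sub>R fst p)) \<in> borel_measurable borel"
      by (intro borel_measurable_continuous_onI continuous_intros)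
    from indep_var_disjoint_dyads[OF nk this]
    show "indep_var borel (\<lambda>\<omega>. v \<bullet> (u \<omega> n *\<^sub>R x \<omega> n)) borel (\<lambda>\<omega>. v \<bullet> (u \<omega> k *\<^sub>R x \<omega> k))"
      by simp
  qed simp_all
  finally have "v \<bullet> (Omega M N x u *v v) \<le> 8 * real N * real (M_high G N psi) * (Cu * Cx)\<^sup>2" .
  moreover have "lambda_min (Omega M N x u) * (v \<bullet> v) \<le> v \<bullet> (Omega M N x u *v v)"
    using lambda_min_ge_iff[OF sym] by blast
  ultimately show ?thesis using v by (simp add: power2_norm_eq_inner[symmetric])
qed

end

section \<open>Measurability of the eigenvalue and rank events\<close>

lemma transpose_Q_hat: "transpose (Q_hat N x) = Q_hat N x"
  unfolding Q_hat_def by (simp add: transpose_scalar transpose_sum_outer)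

text \<open>The event is the preimage of an intersection of closed half-spaces of matrices, one for
  each \<open>v\<close>; measurability of \<open>lambda_min\<close> as a function is thereby
  bypassed.\<close>

lemma sets_lambda_min_Q_hat:
  fixes x :: "'a \<Rightarrow> nat \<Rightarrow> real^'k"
  assumes "\<And>n. n \<in> {1..N} \<Longrightarrow> (\<lambda>\<omega>. x \<omega> n) \<in> borel_measurable M"
  shows "{\<omega> \<in> space M. c \<le> lambda_min (Q_hat N (x \<omega>))} \<in> sets M"
proof -
  let ?C = "{A::real^'k^'k. \<forall>v. c * (v \<bullet> v) \<le> v \<bullet> (A *v v)}"
  have "?C = (\<Inter>v. {A::real^'k^'k. c * (v \<bullet> v) \<le> v \<bullet> (A *v v)})" by auto
  moreover have "closed {A::real^'k^'k. c * (v \<bullet> v) \<le> v \<bullet> (A *v v)}" for v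
    by (intro closed_Collect_le continuous_on_const linear_continuous_on bounded_linear_quadratic_form)
  ultimately have "closed ?C" by auto
  moreover have "(\<lambda>\<omega>. Q_hat N (x \<omega>)) \<in> borel_measurable M"
    unfolding Q_hat_def by (intro borel_measurable_scaleR borel_measurable_const borel_measurable_sum_outer assms)
  ultimately have "(\<lambda>\<omega>. Q_hat N (x \<omega>)) -` ?C \<inter> space M \<in> sets M"
    by (intro measurable_sets[where A = borel] borel_closed) auto
  then show ?thesis
    by (simp add: lambda_min_ge_iff transpose_Q_hat vimage_def Int_def conj_commute)
qed

lemma borel_measurable_det:
  fixes A :: "'a \<Rightarrow> real^'k^'k"
  assumes "A \<in> borel_measurable M"
  shows "(\<lambda>\<omega>. det (A \<omega>)) \<in> borel_measurable M"
  unfolding det_def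
  by (intro borel_measurable_sum borel_measurable_times borel_measurable_prod borel_measurable_const
      borel_measurable_vec_nth assms)

text \<open>Invertibility means a nonzero determinant, which is polynomial in the entries.\<close>

lemma sets_jack_full_rank:
  fixes x :: "'a \<Rightarrow> nat \<Rightarrow> real^'k"
  assumes "\<And>n. n \<in> {1..N} \<Longrightarrow> (\<lambda>\<omega>. x \<omega> n) \<in> borel_measurable M"
  shows "{\<omega> \<in> space M. jack_full_rank G N psi (x \<omega>)} \<in> sets M"
proof -
  have "(\<lambda>\<omega>. det (A_del N psi (x \<omega>) g)) \<in> borel_measurable M" for g
    unfolding A_del_eq_sum by (intro borel_measurable_det borel_measurable_sum_outer assms) auto
  then show ?thesis unfolding jack_full_rank_def invertible_det_nz by measurable
qed

subsection \<open>Concentration of the empirical second moment matrix\<close>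

text \<open>Each of the \<open>(real CARD('k))\<^sup>2\<close> terms of the expanded difference is
  at most \<open>e\<close> times the squared norm of \<open>v\<close>.\<close>

lemma quadratic_form_diff_le:
  fixes A B :: "real^'k^'k"
  assumes "\<And>i j. \<bar>A $ i $ j - B $ i $ j\<bar> \<le> e"
  shows "\<bar>v \<bullet> (A *v v) - v \<bullet> (B *v v)\<bar> \<le> (real CARD('k))\<^sup>2 * e * (v \<bullet> v)"
proof -
  have e: "v \<bullet> (A *v v) - v \<bullet> (B *v v) = (\<Sum>i\<in>UNIV. \<Sum>j\<in>UNIV. v $ i * ((A $ i $ j - B $ i $ j) * v $ j))"
    by (simp add: inner_vec_def matrix_vector_mult_def sum_distrib_left sum_subtractf algebra_simps)
  have "\<bar>v $ i * ((A $ i $ j - B $ i $ j) * v $ j)\<bar> \<le> norm v * (e * norm v)" for i j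
    unfolding abs_mult
    by (intro mult_mono component_le_norm_cart assms) (auto intro: order_trans[OF abs_ge_zero assms])
  then have "\<bar>v \<bullet> (A *v v) - v \<bullet> (B *v v)\<bar> \<le> (\<Sum>i\<in>(UNIV::'k set). \<Sum>j\<in>(UNIV::'k set). norm v * (e * norm v))"
    unfolding e by (intro order_trans[OF sum_abs] sum_mono)
  also have "\<dots> = (real CARD('k))\<^sup>2 * e * (v \<bullet> v)"
    by (simp add: power2_eq_square power2_norm_eq_inner[symmetric])
  finally show ?thesis .
qed

context dyadic_sample
begin

lemma integrable_outer_x: "n \<in> {1..N} \<Longrightarrow> integrable M (\<lambda>\<omega>. outer (x \<omega> n) (x \<omega> n))"
  using bounded by (intro integrable_outer[where B = Cx] measurable_x) (auto elim!: eventually_mono)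

lemma Q_pop_nth: "Q_pop M N x $ i $ j = (\<Sum>n\<in>{1..N}. expectation (\<lambda>\<omega>. x \<omega> n $ i * x \<omega> n $ j)) / real N"
proof -
  have "(\<integral>\<omega>. outer (x \<omega> n) (x \<omega> n) \<partial>M) $ i $ j = expectation (\<lambda>\<omega>. x \<omega> n $ i * x \<omega> n $ j)"
    if "n \<in> {1..N}" for n
    using integral_bounded_linear[OF bounded_linear_vec_nth2 integrable_outer_x[OF that]]
    by (simp add: outer_def)
  then show ?thesis by (simp add: Q_pop_def)
qed

lemma transpose_Q_pop: "transpose (Q_pop M N x) = Q_pop M N x"
  by (simp add: transpose_def vec_eq_iff Q_pop_nth mult.commute)

text \<open>Either degeneracy would make \<open>Q_pop\<close> the zero matrix. Since
  \<open>Cx\<close> enters the later ratios through even powers, \<open>Cx \<noteq> 0\<close> gives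
  positive denominators.\<close>

lemma Cx_nonzero:
  assumes "cQ > 0" "lambda_min (Q_pop M N x) \<ge> cQ"
  shows "N > 0" "Cx \<noteq> 0"
proof -
  have ne: "Q_pop M N x \<noteq> 0"
    using assms lambda_min_zero[where ?'k = 'k] by auto
  then show "N > 0" by (rule contrapos_np) (simp add: Q_pop_def)
  show "Cx \<noteq> 0"
  proof
    assume "Cx = 0"
    have "(\<integral>\<omega>. outer (x \<omega> n) (x \<omega> n) \<partial>M) = 0" if n: "n \<in> {1..N}" for n
    proof (rule integral_eq_zero_AE)
      show "AE \<omega> in M. outer (x \<omega> n) (x \<omega> n) = 0"
        using bounded[OF n] by eventually_elim (simp add: \<open>Cx = 0\<close> outer_def vec_eq_iff)
    qed
    then show False using ne by (simp add: Q_pop_def)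
  qed
qed

text \<open>Chebyshev's inequality for the unnormalised entry at level \<open>e * real N\<close>:
  the variance is of order \<open>N * M_high\<close>, and division by the squared level leaves the
  ratio of \<open>M_high\<close> to \<open>N\<close>.\<close>

lemma prob_Q_hat_nth_deviation_le:
  assumes "N > 0" "e > 0"
  shows "prob {\<omega> \<in> space M. e \<le> \<bar>Q_hat N (x \<omega>) $ i $ j - Q_pop M N x $ i $ j\<bar>}
    \<le> 8 * Cx ^ 4 / e\<^sup>2 * (real (M_high G N psi) / real N)"
proof -
  let ?X = "\<lambda>n \<omega>. x \<omega> n $ i * x \<omega> n $ j"
  let ?S = "\<lambda>\<omega>. \<Sum>n\<in>{1..N}. ?X n \<omega>"
  have bdX: "AE \<omega> in M. \<bar>?X n \<omega>\<bar> \<le> Cx\<^sup>2" if n: "n \<in> {1..N}" for n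
    using bounded[OF n]
  proof eventually_elim
    case (elim \<omega>)
    have "\<bar>x \<omega> n $ i\<bar> \<le> Cx" "\<bar>x \<omega> n $ j\<bar> \<le> Cx"
      using elim component_le_norm_cart order_trans by blast+
    then show ?case unfolding abs_mult power2_eq_square by (intro mult_mono) auto
  qed
  have mX: "?X n \<in> borel_measurable M" if "n \<in> {1..N}" for n
    by (intro borel_measurable_times borel_measurable_vec_nth measurable_x that)
  have mS: "?S \<in> borel_measurable M" using mX by (intro borel_measurable_sum)
  have iX: "integrable M (?X n)" if "n \<in> {1..N}" for n
    using bdX[OF that] mX[OF that] by (intro integrable_const_bound[of _ "Cx\<^sup>2"]) auto
  have "AE \<omega> in M. \<forall>n\<in>{1..N}. \<bar>?X n \<omega>\<bar> \<le> Cx\<^sup>2"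
    using bdX by (intro AE_finite_allI) auto
  then have "AE \<omega> in M. norm ((?S \<omega>)\<^sup>2) \<le> (\<Sum>n\<in>{1..N}. Cx\<^sup>2)\<^sup>2"
  proof eventually_elim
    case (elim \<omega>)
    then have "\<bar>?S \<omega>\<bar> \<le> (\<Sum>n\<in>{1..N}. Cx\<^sup>2)"
      by (intro order_trans[OF sum_abs] sum_mono) blast
    then have "\<bar>?S \<omega>\<bar>\<^sup>2 \<le> (\<Sum>n\<in>{1..N}. Cx\<^sup>2)\<^sup>2" by (intro power_mono) auto
    then show ?case by simp
  qed
  then have iS: "integrable M (\<lambda>\<omega>. (?S \<omega>)\<^sup>2)"
    using mS by (intro integrable_const_bound) auto
  have "{\<omega> \<in> space M. e \<le> \<bar>Q_hat N (x \<omega>) $ i $ j - Q_pop M N x $ i $ j\<bar>}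
      = {\<omega> \<in> space M. e * real N \<le> \<bar>?S \<omega> - expectation ?S\<bar>}"
  proof -
    have "Q_hat N (x \<omega>) $ i $ j - Q_pop M N x $ i $ j = (?S \<omega> - expectation ?S) / real N" for \<omega>
      using iX by (simp add: Q_pop_nth Q_hat_def outer_def diff_divide_distrib Bochner_Integration.integral_sum)
    then show ?thesis using assms by (simp add: abs_divide pos_le_divide_eq)
  qed
  also have "prob \<dots> \<le> variance ?S / (e * real N)\<^sup>2"
    using assms by (intro Chebyshev_inequality mS iS) auto
  also have "variance ?S \<le> 8 * real N * real (M_high G N psi) * (Cx\<^sup>2)\<^sup>2"
  proof (rule variance_dyadic_sum_le[OF support mX bdX])
    fix n m assume nm: "n \<in> {1..N}" "m \<in> {1..N}" "psi n \<inter> psi m = {}"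
    have "(\<lambda>p::(real^'k) \<times> real. fst p $ i * fst p $ j) \<in> borel_measurable borel"
      by (intro borel_measurable_continuous_onI continuous_intros)
    from indep_var_disjoint_dyads[OF nm this]
    show "indep_var borel (?X n) borel (?X m)" by simp
  qed
  also have "8 * real N * real (M_high G N psi) * (Cx\<^sup>2)\<^sup>2 / (e * real N)\<^sup>2
      = 8 * Cx ^ 4 / e\<^sup>2 * (real (M_high G N psi) / real N)"
    using assms by (simp add: field_simps power2_eq_square power4_eq_xxxx)
  finally show ?thesis by (simp add: divide_right_mono)
qed

lemma prob_lambda_min_Q_hat_ge:
  assumes cQ: "cQ > 0" and ident: "lambda_min (Q_pop M N x) \<ge> cQ"
  shows "prob {\<omega> \<in> space M. lambda_min (Q_hat N (x \<omega>)) \<ge> cQ / 2}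
    \<ge> 1 - 32 * real CARD('k) ^ 6 * Cx ^ 4 / cQ\<^sup>2 * (real (M_high G N psi) / real N)"
proof -
  \<comment> \<open>Chosen so that entrywise errors up to \<open>e\<close> change the quadratic form
    by at most half of \<open>cQ\<close>. In the union bound its inverse square contributes
    \<open>4 * real CARD('k) ^ 4 / cQ\<^sup>2\<close>, and the number of entries supplies the
    remaining two powers.\<close>
  define e where "e = cQ / (2 * (real CARD('k))\<^sup>2)"
  have k: "real CARD('k) > 0" by simp
  have e: "e > 0" using cQ by (simp add: e_def)
  define D where "D p = {\<omega> \<in> space M. e \<le> \<bar>Q_hat N (x \<omega>) $ fst p $ snd p - Q_pop M N x $ fst p $ snd p\<bar>}"
    for p :: "'k \<times> 'k"
  let ?E = "{\<omega> \<in> space M. lambda_min (Q_hat N (x \<omega>)) \<ge> cQ / 2}"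
  have D: "D p \<in> events" for p
  proof -
    have "(\<lambda>\<omega>. Q_hat N (x \<omega>) $ fst p $ snd p) \<in> borel_measurable M"
      unfolding Q_hat_def
      by (intro borel_measurable_vec_nth borel_measurable_scaleR borel_measurable_const
          borel_measurable_sum_outer measurable_x)
    then show ?thesis unfolding D_def by measurable
  qed
  have E: "?E \<in> events" by (intro sets_lambda_min_Q_hat measurable_x)
  have "space M - ?E \<subseteq> (\<Union>p. D p)"
  proof (rule subsetI, rule ccontr)
    fix \<omega> assume \<omega>: "\<omega> \<in> space M - ?E" "\<omega> \<notin> (\<Union>p. D p)"
    then have "\<omega> \<notin> D (i, j)" for i j by blast
    then have "\<bar>Q_hat N (x \<omega>) $ i $ j - Q_pop M N x $ i $ j\<bar> \<le> e" for i j
      using \<omega>(1) by (simp add: D_def not_le less_imp_le)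
    from quadratic_form_diff_le[OF this]
    have "\<bar>v \<bullet> (Q_hat N (x \<omega>) *v v) - v \<bullet> (Q_pop M N x *v v)\<bar> \<le> cQ / 2 * (v \<bullet> v)" for v
      using k by (simp add: e_def)
    moreover have "cQ * (v \<bullet> v) \<le> v \<bullet> (Q_pop M N x *v v)" for v
      using ident lambda_min_ge_iff[OF transpose_Q_pop] by blast
    ultimately have "cQ / 2 * (v \<bullet> v) \<le> v \<bullet> (Q_hat N (x \<omega>) *v v)" for v
      by (smt (verit) field_sum_of_halves mult.commute times_divide_eq_right)
    then have "cQ / 2 \<le> lambda_min (Q_hat N (x \<omega>))"
      using lambda_min_ge_iff[OF transpose_Q_hat] by blast
    then show False using \<omega> by simp
  qed
  then have "prob (space M - ?E) \<le> prob (\<Union>p. D p)"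
    using D by (intro finite_measure_mono) auto
  also have "\<dots> \<le> (\<Sum>p\<in>UNIV. prob (D p))"
    using D by (intro finite_measure_subadditive_finite) auto
  also have "\<dots> \<le> (\<Sum>p\<in>(UNIV :: ('k \<times> 'k) set). 8 * Cx ^ 4 / e\<^sup>2 * (real (M_high G N psi) / real N))"
    unfolding D_def using Cx_nonzero[OF assms] e
    by (intro sum_mono prob_Q_hat_nth_deviation_le)
  also have "\<dots> = 32 * real CARD('k) ^ 6 * Cx ^ 4 / cQ\<^sup>2 * (real (M_high G N psi) / real N)"
    using cQ by (simp add: e_def power2_eq_square numeral_eq_Suc field_simps)
  finally show ?thesis using prob_compl[OF E] by simp
qed

text \<open>Multiplying the ratio by the squared smallest eigenvalue and inserting the upper bound
  of order \<open>N * M_high\<close> for the latter produces exactly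
  \<open>N * M_high ^ 3\<close>.\<close>

lemma M_high_ratio_le:
  assumes "N > 0" "pos_definite (Omega M N x u)"
  shows "real (M_high G N psi) / real N \<le> (8 * (Cu * Cx)\<^sup>2)\<^sup>2
    * (real N * real (M_high G N psi) ^ 3 / (lambda_min (Omega M N x u))\<^sup>2)"
proof -
  let ?l = "lambda_min (Omega M N x u)" and ?m = "real (M_high G N psi)" and ?K = "8 * (Cu * Cx)\<^sup>2"
  have sym: "transpose (Omega M N x u) = Omega M N x u"
    using assms by (simp add: pos_definite_def)
  have l: "?l > 0" using assms(2) by (rule lambda_min_pos)
  have "?l \<le> ?K * real N * ?m" using lambda_min_Omega_le[OF sym] by (simp add: mult_ac)
  then have "?l\<^sup>2 \<le> (?K * real N * ?m)\<^sup>2" using l by (intro power_mono) auto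
  then have "?m / real N * ?l\<^sup>2 \<le> ?m / real N * (?K * real N * ?m)\<^sup>2"
    by (intro mult_left_mono) auto
  also have "\<dots> = ?K\<^sup>2 * (real N * ?m ^ 3)"
    using assms(1) by (simp add: power2_eq_square power3_eq_cube)
  finally show ?thesis using l by (simp add: pos_le_divide_eq)
qed

end

subsection \<open>Deletion bounds\<close>

lemma norm_sum_outer_mult_le:
  assumes "\<And>n. n \<in> S \<Longrightarrow> norm (x n) \<le> C"
  shows "norm ((\<Sum>n\<in>S. outer (x n) (x n)) *v w) \<le> real (card S) * C\<^sup>2 * norm w"
proof -
  have "norm ((\<Sum>n\<in>S. outer (x n) (x n)) *v w) \<le> (\<Sum>n\<in>S. C\<^sup>2 * norm w)"
    unfolding sum_outer_mult_vec
  proof (rule sum_norm_le)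
    fix n assume n: "n \<in> S"
    have C: "0 \<le> C" using order_trans[OF norm_ge_zero assms[OF n]] .
    have "\<bar>x n \<bullet> w\<bar> \<le> C * norm w"
      using Cauchy_Schwarz_ineq2 mult_right_mono[OF assms[OF n] norm_ge_zero] by (rule order_trans)
    then have "\<bar>x n \<bullet> w\<bar> * norm (x n) \<le> (C * norm w) * C"
      using assms[OF n] C by (intro mult_mono) auto
    then show "norm ((x n \<bullet> w) *\<^sub>R x n) \<le> C\<^sup>2 * norm w" by (simp add: power2_eq_square mult_ac)
  qed
  then show ?thesis by simp
qed

text \<open>Coercivity: for \<open>w = matrix_inv A *v z\<close> the lower bound on the form and
  Cauchy-Schwarz give \<open>c * (norm w)\<^sup>2 \<le> norm w * norm z\<close>.\<close>

lemma norm_matrix_inv_mult_le: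
  fixes A :: "real^'k^'k"
  assumes "transpose A = A" "c > 0" "c \<le> lambda_min A"
  shows "invertible A" "norm (matrix_inv A *v z) \<le> norm z / c"
proof -
  have q: "c * (v \<bullet> v) \<le> v \<bullet> (A *v v)" for v
    using lambda_min_ge_iff[OF assms(1)] assms(3) by blast
  show inv: "invertible A"
  proof (rule invertible_if_inj)
    fix v assume "A *v v = 0"
    then have "v \<bullet> v \<le> 0" using q[of v] assms(2) by (simp add: mult_le_0_iff)
    then show "v = 0" by (metis inner_gt_zero_iff not_less)
  qed
  let ?w = "matrix_inv A *v z"
  have "c * (norm ?w)\<^sup>2 \<le> ?w \<bullet> z"
    using q[of ?w] by (simp add: matrix_inv_mult_vec[OF inv] power2_norm_eq_inner)
  also have "\<dots> \<le> norm ?w * norm z" by (rule norm_cauchy_schwarz)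
  finally have "norm ?w * (c * norm ?w) \<le> norm ?w * norm z" by (simp add: power2_eq_square mult_ac)
  then have "c * norm ?w \<le> norm z"
    by (cases "norm ?w = 0") (simp_all add: mult_le_cancel_left_pos)
  then show "norm ?w \<le> norm z / c" using assms(2) by (simp add: pos_le_divide_eq mult.commute)
qed

text \<open>The resolvent identity; for \<open>A_full\<close> and \<open>A_del\<close> the middle
  factor is \<open>A_unit\<close>.\<close>

lemma matrix_inv_diff:
  fixes A B :: "real^'k^'k"
  assumes "invertible A" "invertible B"
  shows "matrix_inv B - matrix_inv A = matrix_inv A ** (A - B) ** matrix_inv B"
proof -
  have "matrix_inv A *v ((A - B) *v (matrix_inv B *v z)) = (matrix_inv B - matrix_inv A) *v z" for z
    using assms by (simp add: matrix_vector_mult_diff_rdistrib matrix_vector_mult_diff_distrib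
        matrix_inv_mult_vec)
  then show ?thesis by (simp add: matrix_eq matrix_vector_mul_assoc[symmetric])
qed

lemma transpose_A_full: "transpose (A_full N x) = A_full N x"
  unfolding A_full_def by (rule transpose_sum_outer)

text \<open>The deterministic part, for one realised sample. The form of \<open>A_full\<close> has
  lower bound \<open>cQ * real N / 2\<close>; deleting a unit costs at most
  \<open>cQ * real N / 4\<close>, so a quarter remains. The norm of \<open>A_unit\<close> is at most
  \<open>M_count * Cx\<^sup>2\<close>, and dividing by the remaining bound gives the stated
  ratio.\<close>

lemma jackknife_deletion_bounds:
  fixes x :: "nat \<Rightarrow> real^'k"
  assumes bd: "\<And>n. n \<in> {1..N} \<Longrightarrow> norm (x n) \<le> Cx"
    and cQ: "cQ > 0" and lmin: "lambda_min (Q_hat N x) \<ge> cQ / 2"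
    and ratio: "real (M_high G N psi) / real N \<le> cQ / (4 * Cx\<^sup>2)"
  shows "\<forall>g\<in>{1..G}. lambda_min (A_del N psi x g) \<ge> cQ * real N / 4"
    and "jack_full_rank G N psi x"
    and "full_rank N x"
    and "\<forall>g\<in>{1..G}. spectral_norm (A_unit N psi x g ** matrix_inv (A_del N psi x g))
           \<le> 4 * Cx\<^sup>2 * real (M_count N psi g) / (cQ * real N)"
    and "4 * Cx\<^sup>2 * real (M_high G N psi) / (cQ * real N) \<le> 1"
    and "\<forall>g\<in>{1..G}. matrix_inv (A_del N psi x g) - matrix_inv (A_full N x)
           = matrix_inv (A_full N x) ** A_unit N psi x g ** matrix_inv (A_del N psi x g)"
proof -
  have Qq: "cQ / 2 * (v \<bullet> v) \<le> v \<bullet> (Q_hat N x *v v)" for v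
    using lmin lambda_min_ge_iff[OF transpose_Q_hat] by blast
  have ne: "Q_hat N x \<noteq> 0"
    using lmin cQ lambda_min_zero[where ?'k = 'k] by auto
  then have N: "real N > 0" by (cases "N = 0") (auto simp: Q_hat_def)
  \<comment> \<open>Secures the denominator in \<open>ratio\<close>, as division by zero is zero in
    HOL.\<close>
  have Cx: "Cx \<noteq> 0"
  proof
    assume "Cx = 0"
    then have "x n = 0" if "n \<in> {1..N}" for n using bd[OF that] by simp
    then show False using ne by (simp add: Q_hat_def outer_def vec_eq_iff)
  qed
  have mN: "real (M_high G N psi) * Cx\<^sup>2 \<le> cQ * real N / 4"
    using ratio N Cx by (simp add: field_simps)
  then show "4 * Cx\<^sup>2 * real (M_high G N psi) / (cQ * real N) \<le> 1"
    using N cQ by (simp add: field_simps)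
  have "A_full N x = real N *\<^sub>R Q_hat N x" using N by (simp add: A_full_def Q_hat_def)
  then have Aq: "cQ * real N / 2 * (v \<bullet> v) \<le> v \<bullet> (A_full N x *v v)" for v
    using mult_left_mono[OF Qq[of v], of "real N"]
    by (simp add: scaleR_matrix_vector_assoc[symmetric] mult_ac)
  have "cQ * real N / 2 \<le> lambda_min (A_full N x)"
    using Aq lambda_min_ge_iff[OF transpose_A_full] by blast
  then have inv: "invertible (A_full N x)"
    using N cQ by (intro norm_matrix_inv_mult_le(1)[of _ "cQ * real N / 2"])
      (simp_all add: transpose_A_full)
  then show "full_rank N x" by (simp add: full_rank_def)
  have Uw: "norm (A_unit N psi x g *v w) \<le> real (M_count N psi g) * Cx\<^sup>2 * norm w" for g w
    unfolding A_unit_def M_count_def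
    by (rule norm_sum_outer_mult_le) (auto simp: obs_of_def intro: bd)
  have sym: "transpose (A_del N psi x g) = A_del N psi x g" for g
    unfolding A_del_eq_sum by (rule transpose_sum_outer)
  have del: "lambda_min (A_del N psi x g) \<ge> cQ * real N / 4" if g: "g \<in> {1..G}" for g
    unfolding lambda_min_ge_iff[OF sym]
  proof
    fix v
    have "v \<bullet> (A_unit N psi x g *v v) \<le> norm v * norm (A_unit N psi x g *v v)"
      by (rule norm_cauchy_schwarz)
    also have "\<dots> \<le> norm v * (real (M_count N psi g) * Cx\<^sup>2 * norm v)"
      by (intro mult_left_mono Uw) auto
    also have "\<dots> = real (M_count N psi g) * Cx\<^sup>2 * (v \<bullet> v)"
      by (simp add: power2_norm_eq_inner[symmetric] power2_eq_square)
    also have "\<dots> \<le> cQ * real N / 4 * (v \<bullet> v)"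
      using M_count_le_M_high[OF g, of N psi]
      by (intro mult_right_mono order_trans[OF mult_right_mono mN]) auto
    finally show "cQ * real N / 4 * (v \<bullet> v) \<le> v \<bullet> (A_del N psi x g *v v)"
      using Aq[of v] by (simp add: A_del_def matrix_vector_mult_diff_rdistrib inner_diff_right)
  qed
  then show "\<forall>g\<in>{1..G}. lambda_min (A_del N psi x g) \<ge> cQ * real N / 4" by blast
  have c: "cQ * real N / 4 > 0" using N cQ by simp
  note del_inv = norm_matrix_inv_mult_le[OF sym c del]
  show "jack_full_rank G N psi x" using del_inv(1) by (simp add: jack_full_rank_def)
  show "\<forall>g\<in>{1..G}. matrix_inv (A_del N psi x g) - matrix_inv (A_full N x)
           = matrix_inv (A_full N x) ** A_unit N psi x g ** matrix_inv (A_del N psi x g)"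
    using matrix_inv_diff[OF inv del_inv(1)] by (simp add: A_del_def)
  show "\<forall>g\<in>{1..G}. spectral_norm (A_unit N psi x g ** matrix_inv (A_del N psi x g))
           \<le> 4 * Cx\<^sup>2 * real (M_count N psi g) / (cQ * real N)"
    unfolding spectral_norm_def
  proof (intro ballI onorm_le)
    fix g z assume g: "g \<in> {1..G}"
    have "norm (A_unit N psi x g *v (matrix_inv (A_del N psi x g) *v z))
        \<le> real (M_count N psi g) * Cx\<^sup>2 * (norm z / (cQ * real N / 4))"
      by (intro order_trans[OF Uw] mult_left_mono del_inv(2) g) auto
    then show "norm ((A_unit N psi x g ** matrix_inv (A_del N psi x g)) *v z)
        \<le> 4 * Cx\<^sup>2 * real (M_count N psi g) / (cQ * real N) * norm z"
      by (simp add: matrix_vector_mul_assoc mult_ac)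
  qed
qed

section \<open>Limits along the triangular array and the combined statement\<close>

theorem mainTheorem5:
  fixes M :: "nat \<Rightarrow> 'a measure"
    and N :: "nat \<Rightarrow> nat"
    and psi :: "nat \<Rightarrow> nat \<Rightarrow> nat set"
    and x :: "nat \<Rightarrow> 'a \<Rightarrow> nat \<Rightarrow> real^'k"
    and u y :: "nat \<Rightarrow> 'a \<Rightarrow> nat \<Rightarrow> real"
    and \<beta> :: "nat \<Rightarrow> real^'k"
    and Cx Cu cQ :: real
    and \<rho>g :: "nat \<Rightarrow> nat \<Rightarrow> real"
    and \<rho> :: "nat \<Rightarrow> real"
  assumes prob: "\<forall>G\<ge>2. prob_space (M G)"
    and support: "\<forall>G\<ge>2. \<forall>n\<in>{1..N G}. psi G n \<in> dyads G"
    and random_x: "\<forall>G\<ge>2. \<forall>n\<in>{1..N G}. (\<lambda>\<omega>. x G \<omega> n) \<in> borel_measurable (M G)"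
    and random_u: "\<forall>G\<ge>2. \<forall>n\<in>{1..N G}. (\<lambda>\<omega>. u G \<omega> n) \<in> borel_measurable (M G)"
    and model: "\<forall>G\<ge>2. \<forall>\<omega>\<in>space (M G). \<forall>n\<in>{1..N G}. y G \<omega> n = \<beta> G \<bullet> x G \<omega> n + u G \<omega> n"
    and dyadic_dependence: "\<forall>G\<ge>2. \<forall>S1 S2. S1 \<subseteq> {1..N G} \<and> S2 \<subseteq> {1..N G} \<and> S1 \<inter> S2 = {} \<and>
          (\<forall>n\<in>S1. \<forall>m\<in>S2. psi G n \<inter> psi G m = {}) \<longrightarrow>
          prob_space.indep_var (M G)
            (Pi\<^sub>M S1 (\<lambda>_. borel :: ((real^'k) \<times> real) measure)) (\<lambda>\<omega>. \<lambda>n\<in>S1. (x G \<omega> n, u G \<omega> n))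
            (Pi\<^sub>M S2 (\<lambda>_. borel :: ((real^'k) \<times> real) measure)) (\<lambda>\<omega>. \<lambda>m\<in>S2. (x G \<omega> m, u G \<omega> m))"
    and bounded_support: "\<forall>G\<ge>2. \<forall>n\<in>{1..N G}. AE \<omega> in M G. norm (x G \<omega> n) \<le> Cx \<and> \<bar>u G \<omega> n\<bar> \<le> Cu"
    and exogeneity: "\<forall>G\<ge>2. \<forall>n\<in>{1..N G}. (\<integral>\<omega>. u G \<omega> n *\<^sub>R x G \<omega> n \<partial>M G) = 0"
    and cQ_pos: "cQ > 0"
    and identification: "\<forall>G\<ge>2. lambda_min (Q_pop (M G) (N G) (x G)) \<ge> cQ"
    and Omega_pos: "\<forall>G\<ge>2. pos_definite (Omega (M G) (N G) (x G) (u G))"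
    and variance_accumulation:
      "(\<lambda>G. real (N G) * real (M_high G (N G) (psi G)) ^ 3
             / (lambda_min (Omega (M G) (N G) (x G) (u G)))\<^sup>2) \<longlonglongrightarrow> 0"
    and configuration: "\<forall>\<^sub>F G in sequentially. M_low G (N G) (psi G) \<ge> 1"
    and rho_g: "\<forall>G g. \<rho>g G g = 4 * Cx\<^sup>2 * real (M_count (N G) (psi G) g) / (cQ * real (N G))"
    and rho: "\<forall>G. \<rho> G = 4 * Cx\<^sup>2 * real (M_high G (N G) (psi G)) / (cQ * real (N G))"
  shows
    \<comment> \<open>(a)\<close>
    "(\<forall>G\<ge>2. real (M_high G (N G) (psi G)) / real (N G) \<le> cQ / (4 * Cx\<^sup>2) \<longrightarrow>
        (AE \<omega> in M G. lambda_min (Q_hat (N G) (x G \<omega>)) \<ge> cQ / 2 \<longrightarrow>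
           (\<forall>g\<in>{1..G}. lambda_min (A_del (N G) (psi G) (x G \<omega>) g) \<ge> cQ * real (N G) / 4) \<and>
           jack_full_rank G (N G) (psi G) (x G \<omega>) \<and>
           full_rank (N G) (x G \<omega>) \<and>
           (\<forall>g\<in>{1..G}.
              spectral_norm (A_unit (N G) (psi G) (x G \<omega>) g
                  ** matrix_inv (A_del (N G) (psi G) (x G \<omega>) g)) \<le> \<rho>g G g \<and>
              \<rho>g G g \<le> \<rho> G \<and> \<rho> G \<le> 1 \<and>
              matrix_inv (A_del (N G) (psi G) (x G \<omega>) g) - matrix_inv (A_full (N G) (x G \<omega>))
                = matrix_inv (A_full (N G) (x G \<omega>)) ** A_unit (N G) (psi G) (x G \<omega>) g
                    ** matrix_inv (A_del (N G) (psi G) (x G \<omega>) g))))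
     \<and> (\<lambda>G. measure (M G) {\<omega>\<in>space (M G). lambda_min (Q_hat (N G) (x G \<omega>)) \<ge> cQ / 2 \<and>
             real (M_high G (N G) (psi G)) / real (N G) \<le> cQ / (4 * Cx\<^sup>2)}) \<longlonglongrightarrow> 1
     \<and> (\<lambda>G. measure (M G) {\<omega>\<in>space (M G). jack_full_rank G (N G) (psi G) (x G \<omega>)}) \<longlonglongrightarrow> 1
     \<comment> \<open>(b)\<close>
     \<and> (\<forall>G\<ge>2. \<forall>\<omega>\<in>space (M G). jack_full_rank G (N G) (psi G) (x G \<omega>) \<longrightarrow>
          (\<forall>g\<in>{1..G}.
             beta_del (N G) (psi G) (x G \<omega>) (y G \<omega>) g - beta_hat (N G) (x G \<omega>) (y G \<omega>)
               = - (matrix_inv (A_del (N G) (psi G) (x G \<omega>) g)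
                      *v T_unit (N G) (psi G) (x G \<omega>) (y G \<omega>) g)))
     \<comment> \<open>(c)\<close>
     \<and> (\<forall>G\<ge>2. \<forall>\<omega>\<in>space (M G). full_rank (N G) (x G \<omega>) \<longrightarrow>
          (\<Sum>g\<in>{1..G}. T_unit (N G) (psi G) (x G \<omega>) (y G \<omega>) g) = 0)
     \<comment> \<open>(d)\<close>
     \<and> (\<forall>G\<ge>2. \<forall>\<omega>\<in>space (M G).
          (\<Sum>g\<in>{1..G}. outer (T_unit (N G) (psi G) (x G \<omega>) (y G \<omega>) g)
                               (T_unit (N G) (psi G) (x G \<omega>) (y G \<omega>) g))
            = Omega_hat (N G) (psi G) (x G \<omega>) (y G \<omega>)
              + (\<Sum>d\<in>dyads G. outer (D_dyad (N G) (psi G) (x G \<omega>) (y G \<omega>) d)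
                                     (D_dyad (N G) (psi G) (x G \<omega>) (y G \<omega>) d)))"
proof -
  let ?ratio = "\<lambda>G. real (M_high G (N G) (psi G)) / real (N G)"
  let ?good = "\<lambda>G. {\<omega>\<in>space (M G). lambda_min (Q_hat (N G) (x G \<omega>)) \<ge> cQ / 2 \<and>
             real (M_high G (N G) (psi G)) / real (N G) \<le> cQ / (4 * Cx\<^sup>2)}"
  let ?jack = "\<lambda>G. {\<omega>\<in>space (M G). jack_full_rank G (N G) (psi G) (x G \<omega>)}"
  have sample: "dyadic_sample (M G) G (N G) (psi G) (x G) (u G) Cx Cu" if "G \<ge> 2" for G
    unfolding dyadic_sample_def dyadic_sample_axioms_def
    using that prob support random_x random_u bounded_support dyadic_dependence
    by (intro conjI allI impI) (simp_all del: Int_iff)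
  have aeb: "AE \<omega> in M G. \<forall>n\<in>{1..N G}. norm (x G \<omega> n) \<le> Cx" if "G \<ge> 2" for G
    using bounded_support that by (intro AE_finite_allI) (auto elim!: eventually_mono)
  \<comment> \<open>Any single row with \<open>G \<ge> 2\<close> decides this, because
    \<open>Cx\<close> is common to all rows.\<close>
  have Cx: "Cx \<noteq> 0"
    using dyadic_sample.Cx_nonzero(2)[OF sample cQ_pos] identification by blast
  have ratio0: "?ratio \<longlonglongrightarrow> 0"
  proof (rule tendsto_sandwich[OF _ _ tendsto_const])
    show "eventually (\<lambda>G. 0 \<le> ?ratio G) sequentially" by simp
    show "eventually (\<lambda>G. ?ratio G \<le> (8 * (Cu * Cx)\<^sup>2)\<^sup>2 * (real (N G) * real (M_high G (N G) (psi G)) ^ 3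
             / (lambda_min (Omega (M G) (N G) (x G) (u G)))\<^sup>2)) sequentially"
      using eventually_ge_at_top[of 2]
    proof eventually_elim
      case (elim G)
      interpret dyadic_sample "M G" G "N G" "psi G" "x G" "u G" Cx Cu using sample[OF elim] .
      show ?case
        using Cx_nonzero(1)[OF cQ_pos] identification Omega_pos elim by (intro M_high_ratio_le) auto
    qed
    show "(\<lambda>G. (8 * (Cu * Cx)\<^sup>2)\<^sup>2 * (real (N G) * real (M_high G (N G) (psi G)) ^ 3
             / (lambda_min (Omega (M G) (N G) (x G) (u G)))\<^sup>2)) \<longlonglongrightarrow> 0"
      using tendsto_mult_left[OF variance_accumulation] by simp
  qed
  have "cQ / (4 * Cx\<^sup>2) > 0" using cQ_pos Cx by simp
  then have "eventually (\<lambda>G. ?ratio G < cQ / (4 * Cx\<^sup>2)) sequentially"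
    by (rule order_tendstoD(2)[OF ratio0])
  then have ev: "eventually (\<lambda>G. G \<ge> 2 \<and> ?ratio G \<le> cQ / (4 * Cx\<^sup>2)) sequentially"
    using eventually_ge_at_top[of 2] by eventually_elim auto
  let ?low = "\<lambda>G. 1 - 32 * real CARD('k) ^ 6 * Cx ^ 4 / cQ\<^sup>2 * ?ratio G"
  have low: "?low \<longlonglongrightarrow> 1"
    using tendsto_diff[OF tendsto_const[of 1]
        tendsto_mult_left[OF ratio0, of "32 * real CARD('k) ^ 6 * Cx ^ 4 / cQ\<^sup>2"]] by simp
  \<comment> \<open>The ratio condition is nonrandom and holds for all large \<open>G\<close>; from
    then on only the eigenvalue event matters, whose probability is at least
    \<open>?low G\<close>.\<close>
  have good: "(\<lambda>G. measure (M G) (?good G)) \<longlonglongrightarrow> 1"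
  proof (rule tendsto_sandwich[OF _ _ low tendsto_const])
    show "eventually (\<lambda>G. ?low G \<le> measure (M G) (?good G)) sequentially"
      using ev
    proof eventually_elim
      case (elim G)
      then interpret dyadic_sample "M G" G "N G" "psi G" "x G" "u G" Cx Cu using sample by blast
      show ?case
        using prob_lambda_min_Q_hat_ge[OF cQ_pos] identification elim by simp
    qed
    show "eventually (\<lambda>G. measure (M G) (?good G) \<le> 1) sequentially"
      using ev by eventually_elim (use prob in \<open>blast intro: prob_space.prob_le_1\<close>)
  qed
  have jack: "(\<lambda>G. measure (M G) (?jack G)) \<longlonglongrightarrow> 1"
  proof (rule tendsto_sandwich[OF _ _ good tendsto_const])
    show "eventually (\<lambda>G. measure (M G) (?good G) \<le> measure (M G) (?jack G)) sequentially"
      using ev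
    proof eventually_elim
      case (elim G)
      then interpret dyadic_sample "M G" G "N G" "psi G" "x G" "u G" Cx Cu using sample by blast
      \<comment> \<open>The inclusion holds only almost surely, since the bound on the regressors
        does; monotonicity of the measure then requires the larger event to be measurable.\<close>
      have "AE \<omega> in M G. \<omega> \<in> ?good G \<longrightarrow> \<omega> \<in> ?jack G"
        using aeb[of G] elim
        by (auto elim!: eventually_mono intro!: jackknife_deletion_bounds(2)[OF _ cQ_pos])
      then show ?case
        by (rule finite_measure_mono_AE) (intro sets_jack_full_rank measurable_x)
    qed
    show "eventually (\<lambda>G. measure (M G) (?jack G) \<le> 1) sequentially"
      using ev by eventually_elim (use prob in \<open>blast intro: prob_space.prob_le_1\<close>)
  qed
  have rho_le: "\<rho>g G g \<le> \<rho> G" if "g \<in> {1..G}" for G g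
    unfolding rho_g[rule_format] rho[rule_format]
    using M_count_le_M_high[OF that] cQ_pos by (intro divide_right_mono mult_left_mono of_nat_mono) auto
  have a: "AE \<omega> in M G. lambda_min (Q_hat (N G) (x G \<omega>)) \<ge> cQ / 2 \<longrightarrow>
           (\<forall>g\<in>{1..G}. lambda_min (A_del (N G) (psi G) (x G \<omega>) g) \<ge> cQ * real (N G) / 4) \<and>
           jack_full_rank G (N G) (psi G) (x G \<omega>) \<and>
           full_rank (N G) (x G \<omega>) \<and>
           (\<forall>g\<in>{1..G}.
              spectral_norm (A_unit (N G) (psi G) (x G \<omega>) g
                  ** matrix_inv (A_del (N G) (psi G) (x G \<omega>) g)) \<le> \<rho>g G g \<and>
              \<rho>g G g \<le> \<rho> G \<and> \<rho> G \<le> 1 \<and>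
              matrix_inv (A_del (N G) (psi G) (x G \<omega>) g) - matrix_inv (A_full (N G) (x G \<omega>))
                = matrix_inv (A_full (N G) (x G \<omega>)) ** A_unit (N G) (psi G) (x G \<omega>) g
                    ** matrix_inv (A_del (N G) (psi G) (x G \<omega>) g))"
    (is "AE \<omega> in M G. _ \<longrightarrow> ?C G \<omega>")
    if G: "G \<ge> 2" and r: "?ratio G \<le> cQ / (4 * Cx\<^sup>2)" for G
    using aeb[OF G]
  proof eventually_elim
    case (elim \<omega>)
    then have "\<And>n. n \<in> {1..N G} \<Longrightarrow> norm (x G \<omega> n) \<le> Cx" by blast
    note b = jackknife_deletion_bounds[where x = "x G \<omega>", OF this cQ_pos _ r]
    show ?case
    proof (intro impI)
      assume q: "cQ / 2 \<le> lambda_min (Q_hat (N G) (x G \<omega>))"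
      show "?C G \<omega>"
        using b[OF _ q] rho_le[of _ G] unfolding rho_g[rule_format] rho[rule_format] by auto
    qed
  qed
  \<comment> \<open>The identities in (b), (c) and (d) are algebraic and hold at every outcome,
    whereas the bounds in (a) carry the null set of the regressor bound.\<close>
  show ?thesis
    using a good jack beta_del_minus_beta_hat sum_T_unit sum_outer_T_unit support
    by (intro conjI allI ballI impI) blast+
qed

end
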